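(* Let $n,k,l,r$ be integers with $r\ge 1$, $1<k<n$ and $1\le l<k$. Let $W=W(n+1,n,r)$ be an $(n+1)$-web given on an $nr$-dimensional manifold $X^{nr}$ by foliations $\lambda_1,\dots,\lambda_{n+1}$ of codimension $r$, with adapted forms $\omega_\xi^i$ ($\xi=1,\dots,n+1$, $i=1,\dots,r$), torsion tensor $a_{\alpha\beta}{}^{i}_{jm}$ ($\alpha\ne\beta$, $\alpha,\beta\in\{1,\dots,n\}$), and local closed form equations $x_{n+1}=F(x_1,\dots,x_n)$. Then the following four statements (the first and the last being understood locally, as explained in the context) are equivalent. (i) $W$ possesses the reduct $(l+1,k)$-reducible $(k+1)$-subweb $[n+1,1,\dots,k]$; that is, for all constants $c_{k+1},\dots,c_n$, $$x_{n+1}=F(x_1,\dots,x_k,c_{k+1},\dots,c_n)=f\bigl(x_1,\dots,x_l,\,g(x_{l+1},\dots,x_k,c_{k+1},\dots,c_n),\,c_{k+1},\dots,c_n\bigr)$$ for some $\mathbb{R}^r$-valued functions $f$ and $g$ that are smooth in the variables $x$ for each fixed value of the constants. (ii) The components $a_{uv}{}^{i}_{jm}$, $u,v=1,\dots,k$, of the torsion tensor of $W$ satisfy $$a_{pa}{}^{i}_{jm}=a_{pb}{}^{i}_{jm}\qquad\text{for all } p=1,\dots,l,\ \ a,b=l+1,\dots,k,\ \ i,j,m=1,\dots,r.$$ (iii) The distribution defined by the equations $$\omega_\sigma^i=0\quad(\sigma=k+1,\dots,n),\qquad \omega_{l+1}^i+\cdots+\omega_k^i=0,\qquad i=1,\dots,r,$$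 is integrable. (iv) The closed form equation of $W$ has the form $$x_{n+1}=F(x_1,\dots,x_n)=f\bigl(x_1,\dots,x_l,\,g(x_{l+1},\dots,x_k,x_{k+1},\dots,x_n),\,x_{k+1},\dots,x_n\bigr),$$ where $f$ and $g$ are some smooth $\mathbb{R}^r$-valued functions of $n-k+l+1$ and $n-l$ ($\mathbb{R}^r$-valued) variables, respectively.
   Context: All objects are smooth. An $(n+1)$-web $W(n+1,n,r)$ on a manifold $X^{nr}$ of dimension $nr$ consists of $n+1$ foliations $\lambda_1,\dots,\lambda_{n+1}$ of codimension $r$, any $n$ of which are in general position (their conormal spaces span the cotangent space at each point). Closed form equations: locally, in a domain $D\subset X^{nr}$, there are coordinates $(x_1,\dots,x_n)$ with $x_\alpha=(x_\alpha^1,\dots,x_\alpha^r)\in\mathbb{R}^r$, and a smooth $\mathbb{R}^r$-valued function $F$ with $\det(\partial F^i/\partial x_\alpha^j)\ne0$ for every $\alpha=1,\dots,n$, such that the leaves of $\lambda_\alpha$ are $x_\alpha=\text{const}$ $(\alpha=1,\dots,n)$ and the leaves of $\lambda_{n+1}$ are $x_{n+1}:=F(x_1,\dots,x_n)=\text{const}$. Statements (i) and (iv) are local: they mean that every point has such a neighbourhood, a product in the coordinates $x_1,\dots,x_n$, on which the stated representation holds (in (i), for all constants $c_\sigma$ in the corresponding coordinate ranges). Adapted co-frame: each $\lambda_\xi$ is defined by the completely integrable Pfaffian system $\omega_\xi^i=0$, $i=1,\dots,r$, $\xi=1,\dots,n+1$, with the forms normalized so that $\omega_1^i+\cdots+\omega_n^i+\omega_{n+1}^i=0$;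 such forms are determined up to a common pointwise $GL(r)$-transformation $\omega_\xi^i\mapsto A^i_j\omega_\xi^j$. For example, one may take $\omega_\alpha^i=\sum_j(\partial F^i/\partial x_\alpha^j)\,dx_\alpha^j$ for $\alpha\le n$ and $\omega_{n+1}^i=-dF^i$. The forms $\omega_\alpha^i$, $\alpha=1,\dots,n$, constitute a co-frame. Torsion tensor: there are unique 1-forms $\omega_j^i$ and functions $a_{\alpha\beta}{}^{i}_{jm}$ ($\alpha\neq\beta$) such that, for $\alpha=1,\dots,n$, $$d\omega_\alpha^i=\omega_\alpha^j\wedge\omega_j^i+\sum_{\beta\ne\alpha}a_{\alpha\beta}{}^{i}_{jm}\,\omega_\alpha^j\wedge\omega_\beta^m,$$ with $a_{\alpha\beta}{}^{i}_{jm}=a_{\beta\alpha}{}^{i}_{mj}$ and $\sum_{\alpha\ne\beta}a_{\alpha\beta}{}^{i}_{jm}=0$ (summation over repeated lower-case indices $j,m=1,\dots,r$). The $a_{\alpha\beta}{}^{i}_{jm}$ form the torsion tensor of $W$. Reduct subweb: $[n+1,1,\dots,k]$ is the $(k+1)$-web cut on the intersections of leaves of the foliations $\lambda_\sigma$, $\sigma=k+1,\dots,n$ (i.e. on the submanifolds $x_\sigma=c_\sigma$, with $c_\sigma\in\mathbb{R}^r$ constant, equivalently on the integral manifolds of $\omega_\sigma^i=0$, $\sigma=k+1,\dots,n$), by the leaves of the foliations $\lambda_1,\dots,\lambda_k,\lambda_{n+1}$. A $(k+1)$-web $x_{n+1}=f(x_1,\dots,x_k)$ is called $(l+1,k)$-reducible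 if $f(x_1,\dots,x_k)$ can be written as $\Phi(x_1,\dots,x_l,g(x_{l+1},\dots,x_k))$ with $\mathbb{R}^r$-valued functions $\Phi$ and $g$; for the reduct subweb this takes the form stated in (i). *)

theory Defs
  imports "HOL-Analysis.Analysis"
begin

section \<open>Smooth maps between Euclidean spaces\<close>

primrec Ck_on :: "nat \<Rightarrow> 'a::euclidean_space set \<Rightarrow> ('a \<Rightarrow> 'b::euclidean_space) \<Rightarrow> bool" where
  "Ck_on 0 S f \<longleftrightarrow> continuous_on S f"
| "Ck_on (Suc n) S f \<longleftrightarrow> (\<forall>x\<in>S. f differentiable (at x)) \<and>
     (\<forall>v. Ck_on n S (\<lambda>x. frechet_derivative f (at x) v))"

text \<open>Meant for open \<open>S\<close>, since the derivatives are two-sided.\<close>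

definition smooth_on :: "'a::euclidean_space set \<Rightarrow> ('a \<Rightarrow> 'b::euclidean_space) \<Rightarrow> bool" where
  "smooth_on S f \<longleftrightarrow> (\<forall>n. Ck_on n S f)"

definition smooth_near :: "'a::euclidean_space set \<Rightarrow> ('a \<Rightarrow> 'b::euclidean_space) \<Rightarrow> bool" where
  "smooth_near S f \<longleftrightarrow> (\<exists>T. open T \<and> S \<subseteq> T \<and> smooth_on T f)"


section \<open>Smooth manifolds of dimension \<open>n r\<close>\<close>

text \<open>
  The manifold is the whole type \<open>'m\<close>.  It is modelled on \<open>real ^ 'r ^ 'n\<close>, so a chart is an
  \<open>n\<close>-tuple of \<open>\<real>\<^sup>r\<close>-valued coordinates, \<open>n = CARD('n)\<close> and \<open>r = CARD('r)\<close>.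
  A chart is a pair of a domain and a coordinate map, whose values off the domain are irrelevant.
\<close>

type_synonym ('r, 'n) coords = "real ^ 'r ^ 'n"
type_synonym ('m, 'r, 'n) chart = "'m set \<times> ('m \<Rightarrow> ('r, 'n) coords)"

abbreviation chart_inv :: "('m, 'r, 'n) chart \<Rightarrow> ('r, 'n) coords \<Rightarrow> 'm" where
  "chart_inv c \<equiv> inv_into (fst c) (snd c)"

definition is_chart :: "('m::topological_space, 'r::finite, 'n::finite) chart \<Rightarrow> bool" where
  "is_chart c \<longleftrightarrow> open (fst c) \<and> open (snd c ` fst c) \<and>
     homeomorphism (fst c) (snd c ` fst c) (snd c) (chart_inv c)"

definition smoothly_compatible ::
    "('m, 'r::finite, 'n::finite) chart \<Rightarrow> ('m, 'r, 'n) chart \<Rightarrow> bool" where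
  "smoothly_compatible c d \<longleftrightarrow>
     smooth_on (snd c ` (fst c \<inter> fst d)) (snd d \<circ> chart_inv c) \<and>
     smooth_on (snd d ` (fst c \<inter> fst d)) (snd c \<circ> chart_inv d)"

text \<open>A smooth structure is a maximal smooth atlas.\<close>

definition smooth_structure ::
    "('m::{t2_space, second_countable_topology}, 'r::finite, 'n::finite) chart set \<Rightarrow> bool" where
  "smooth_structure A \<longleftrightarrow>
     (\<forall>c\<in>A. is_chart c) \<and> (\<Union>c\<in>A. fst c) = UNIV \<and>
     (\<forall>c\<in>A. \<forall>d\<in>A. smoothly_compatible c d) \<and>
     (\<forall>c. is_chart c \<and> (\<forall>d\<in>A. smoothly_compatible c d) \<longrightarrow> c \<in> A)"

definition smooth_map_on ::
    "('m, 'r::finite, 'n::finite) chart set \<Rightarrow> 'm set \<Rightarrow> ('m \<Rightarrow> 'b::euclidean_space) \<Rightarrow> bool" where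
  "smooth_map_on A D f \<longleftrightarrow> (\<forall>c\<in>A. smooth_on (snd c ` (fst c \<inter> D)) (f \<circ> chart_inv c))"

text \<open>
  A tangent vector at \<open>x\<close> is represented by its components \<open>v\<close> in a chart \<open>c\<close> around \<open>x\<close>;
  \<open>differential c f x v\<close> is the value of the differential of \<open>f\<close> on that vector.
\<close>

definition differential ::
    "('m, 'r::finite, 'n::finite) chart \<Rightarrow> ('m \<Rightarrow> 'b::euclidean_space) \<Rightarrow> 'm \<Rightarrow> ('r, 'n) coords \<Rightarrow> 'b" where
  "differential c f x = frechet_derivative (f \<circ> chart_inv c) (at (snd c x))"

definition submersion_on ::
    "('m, 'r::finite, 'n::finite) chart set \<Rightarrow> 'm set \<Rightarrow> ('m \<Rightarrow> 'b::euclidean_space) \<Rightarrow> bool" where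
  "submersion_on A D f \<longleftrightarrow> smooth_map_on A D f \<and>
     (\<forall>c\<in>A. \<forall>x\<in>fst c \<inter> D. surj (differential c f x))"


section \<open>Foliations and webs\<close>

text \<open>
  A foliation of codimension \<open>r\<close> is given by a Haefliger cocycle: a family of local submersions
  to \<open>\<real>\<^sup>r\<close>, with domains covering the manifold, any two of which locally differ by a smooth
  change of the value.  The leaves are locally the level sets of these submersions.
\<close>

type_synonym ('m, 'r) foliation = "('m set \<times> ('m \<Rightarrow> real ^ 'r)) set"

definition locally_factors ::
    "'m::topological_space set \<Rightarrow> ('m \<Rightarrow> real ^ 'r::finite) \<Rightarrow> ('m \<Rightarrow> real ^ 'r) \<Rightarrow> bool" where
  "locally_factors W f g \<longleftrightarrow>
     (\<forall>x\<in>W. \<exists>N \<gamma>. open N \<and> x \<in> N \<and> N \<subseteq> W \<and> smooth_near (g ` N) \<gamma> \<and> (\<forall>y\<in>N. f y = \<gamma> (g y)))"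

definition foliation ::
    "('m::topological_space, 'r::finite, 'n::finite) chart set \<Rightarrow> ('m, 'r) foliation \<Rightarrow> bool" where
  "foliation A L \<longleftrightarrow>
     (\<Union>(U, f)\<in>L. U) = UNIV \<and>
     (\<forall>(U, f)\<in>L. open U \<and> submersion_on A U f) \<and>
     (\<forall>(U, f)\<in>L. \<forall>(V, g)\<in>L. locally_factors (U \<inter> V) f g)"

text \<open>
  \<open>leaves_given_by A L D f\<close>: on the domain \<open>D\<close> the foliation \<open>L\<close> is the one with leaves
  \<open>f = const\<close>, that is, \<open>f\<close> may be added to the cocycle.
\<close>

definition leaves_given_by ::
    "('m::topological_space, 'r::finite, 'n::finite) chart set \<Rightarrow> ('m, 'r) foliation \<Rightarrow>
     'm set \<Rightarrow> ('m \<Rightarrow> real ^ 'r) \<Rightarrow> bool" where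
  "leaves_given_by A L D f \<longleftrightarrow> open D \<and> submersion_on A D f \<and>
     (\<forall>(V, g)\<in>L. locally_factors (D \<inter> V) f g \<and> locally_factors (D \<inter> V) g f)"

definition leaf_tangent ::
    "('m, 'r::finite) foliation \<Rightarrow> ('m, 'r, 'n::finite) chart \<Rightarrow> 'm \<Rightarrow> ('r, 'n) coords set" where
  "leaf_tangent L c x = {v. \<forall>(U, g)\<in>L. x \<in> U \<longrightarrow> differential c g x v = 0}"

text \<open>
  The conormal space is the annihilator of the tangent space of the leaf, covectors being
  identified with vectors through the inner product of the coordinate space.
\<close>

definition conormal ::
    "('m, 'r::finite) foliation \<Rightarrow> ('m, 'r, 'n::finite) chart \<Rightarrow> 'm \<Rightarrow> ('r, 'n) coords set" where
  "conormal L c x = orthogonal_comp (leaf_tangent L c x)"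

text \<open>
  The foliations \<open>\<lambda>\<^sub>1, \<dots>, \<lambda>\<^sub>n\<close> are indexed by \<open>Some \<alpha>\<close> with \<open>\<alpha> :: 'n\<close>,
  and \<open>\<lambda>\<^sub>n\<^sub>+\<^sub>1\<close> by \<open>None\<close>.
\<close>

definition web ::
    "('m::topological_space, 'r::finite, 'n::finite) chart set \<Rightarrow> ('n option \<Rightarrow> ('m, 'r) foliation) \<Rightarrow> bool" where
  "web A W \<longleftrightarrow> (\<forall>\<xi>. foliation A (W \<xi>)) \<and>
     (\<forall>\<xi>\<^sub>0. \<forall>c\<in>A. \<forall>x\<in>fst c. span (\<Union>\<xi>\<in>- {\<xi>\<^sub>0}. conormal (W \<xi>) c x) = UNIV)"

text \<open>
  The number \<open>1, \<dots>, n\<close> of an index of the linearly ordered type \<open>'n\<close>, and the three groups of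
  indices \<open>1, \<dots>, l\<close> and \<open>l+1, \<dots>, k\<close> and \<open>k+1, \<dots>, n\<close>.
\<close>

definition pos :: "'n::{finite, linorder} \<Rightarrow> nat" where
  "pos \<alpha> = card {..\<alpha>}"

definition idx_p :: "nat \<Rightarrow> 'n::{finite, linorder} set" where
  "idx_p l = {\<alpha>. pos \<alpha> \<le> l}"

definition idx_a :: "nat \<Rightarrow> nat \<Rightarrow> 'n::{finite, linorder} set" where
  "idx_a l k = {\<alpha>. l < pos \<alpha> \<and> pos \<alpha> \<le> k}"

definition idx_s :: "nat \<Rightarrow> 'n::{finite, linorder} set" where
  "idx_s k = {\<alpha>. k < pos \<alpha>}"


section \<open>Closed form equations\<close>

definition partial_jacobian ::
    "(('r::finite, 'n::finite) coords \<Rightarrow> real ^ 'r) \<Rightarrow> 'n \<Rightarrow> ('r, 'n) coords \<Rightarrow> real ^ 'r ^ 'r" where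
  "partial_jacobian F \<alpha> y = matrix (\<lambda>h. frechet_derivative F (at y) (axis \<alpha> h))"

definition closed_form ::
    "('m::topological_space, 'r::finite, 'n::finite) chart set \<Rightarrow> ('n option \<Rightarrow> ('m, 'r) foliation) \<Rightarrow>
     'm set \<Rightarrow> ('m \<Rightarrow> ('r, 'n) coords) \<Rightarrow> (('r, 'n) coords \<Rightarrow> real ^ 'r) \<Rightarrow> bool" where
  "closed_form A W D \<phi> F \<longleftrightarrow>
     (D, \<phi>) \<in> A \<and>
     (\<forall>\<alpha>. leaves_given_by A (W (Some \<alpha>)) D (\<lambda>x. \<phi> x $ \<alpha>)) \<and>
     smooth_on (\<phi> ` D) F \<and>
     (\<forall>\<alpha>. \<forall>y\<in>\<phi> ` D. det (partial_jacobian F \<alpha> y) \<noteq> 0) \<and>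
     leaves_given_by A (W None) D (F \<circ> \<phi>)"

text \<open>
  \<open>block I x\<close> stands for the tuple of those \<open>x\<^sub>\<alpha>\<close> with \<open>\<alpha> \<in> I\<close>; the remaining slots are
  filled with \<open>0\<close>, so that a function applied to \<open>block I x\<close> is a function of these
  variables only.
\<close>

definition block :: "'n set \<Rightarrow> ('r::finite, 'n::finite) coords \<Rightarrow> ('r, 'n) coords" where
  "block I x = (\<chi> \<alpha>. if \<alpha> \<in> I then x $ \<alpha> else 0)"

definition product_domain :: "('n::finite \<Rightarrow> (real ^ 'r::finite) set) \<Rightarrow> ('r, 'n) coords set" where
  "product_domain B = {x. \<forall>\<alpha>. x $ \<alpha> \<in> B \<alpha>}"

text \<open>
  The representation
  \<open>F(x) = f(x\<^sub>1, \<dots>, x\<^sub>l, g(x\<^sub>l\<^sub>+\<^sub>1, \<dots>, x\<^sub>k, c\<^sub>k\<^sub>+\<^sub>1, \<dots>, c\<^sub>n), c\<^sub>k\<^sub>+\<^sub>1, \<dots>, c\<^sub>n)\<close>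
  on a product domain: first with the last variables \<open>c\<close> as parameters, on which \<open>f\<close> and \<open>g\<close>
  may depend arbitrarily, then with \<open>f\<close> and \<open>g\<close> jointly smooth.
\<close>

definition fibrewise_reducible_on ::
    "nat \<Rightarrow> nat \<Rightarrow> ('n::{finite, linorder} \<Rightarrow> (real ^ 'r::finite) set) \<Rightarrow> (('r, 'n) coords \<Rightarrow> real ^ 'r) \<Rightarrow> bool" where
  "fibrewise_reducible_on k l B F \<longleftrightarrow>
     (\<exists>(f :: ('r, 'n) coords \<Rightarrow> real ^ 'r \<Rightarrow> ('r, 'n) coords \<Rightarrow> real ^ 'r)
       (g :: ('r, 'n) coords \<Rightarrow> ('r, 'n) coords \<Rightarrow> real ^ 'r).
       \<forall>c\<in>block (idx_s k) ` product_domain B.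
         smooth_near (block (idx_a l k) ` product_domain B) (\<lambda>u. g u c) \<and>
         smooth_near ((\<lambda>x. (block (idx_p l) x, g (block (idx_a l k) x) c)) ` product_domain B)
           (\<lambda>(u, y). f u y c) \<and>
         (\<forall>x\<in>product_domain B. block (idx_s k) x = c \<longrightarrow>
            F x = f (block (idx_p l) x) (g (block (idx_a l k) x) c) c))"

definition jointly_reducible_on ::
    "nat \<Rightarrow> nat \<Rightarrow> ('n::{finite, linorder} \<Rightarrow> (real ^ 'r::finite) set) \<Rightarrow> (('r, 'n) coords \<Rightarrow> real ^ 'r) \<Rightarrow> bool" where
  "jointly_reducible_on k l B F \<longleftrightarrow>
     (\<exists>(f :: ('r, 'n) coords \<Rightarrow> real ^ 'r \<Rightarrow> ('r, 'n) coords \<Rightarrow> real ^ 'r)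
       (g :: ('r, 'n) coords \<Rightarrow> ('r, 'n) coords \<Rightarrow> real ^ 'r).
       smooth_near ((\<lambda>x. (block (idx_a l k) x, block (idx_s k) x)) ` product_domain B)
         (\<lambda>(u, c). g u c) \<and>
       smooth_near
         ((\<lambda>x. (block (idx_p l) x, g (block (idx_a l k) x) (block (idx_s k) x), block (idx_s k) x))
            ` product_domain B)
         (\<lambda>(u, y, c). f u y c) \<and>
       (\<forall>x\<in>product_domain B.
          F x = f (block (idx_p l) x) (g (block (idx_a l k) x) (block (idx_s k) x)) (block (idx_s k) x)))"

text \<open>
  Given a family \<open>E\<close> of closed form equations, every point has a neighbourhood, a product in the
  coordinates of a member of \<open>E\<close>, on which the representation \<open>P\<close> holds.
\<close>

definition locally_representable ::
    "(('n::finite \<Rightarrow> (real ^ 'r::finite) set) \<Rightarrow> (('r, 'n) coords \<Rightarrow> real ^ 'r) \<Rightarrow> bool) \<Rightarrow>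
     ('m set \<times> ('m \<Rightarrow> ('r, 'n) coords) \<times> (('r, 'n) coords \<Rightarrow> real ^ 'r)) set \<Rightarrow> bool" where
  "locally_representable P E \<longleftrightarrow>
     (\<forall>x. \<exists>(D, \<phi>, F)\<in>E. x \<in> D \<and>
        (\<exists>B. (\<forall>\<alpha>. open (B \<alpha>)) \<and> \<phi> x \<in> product_domain B \<and> product_domain B \<subseteq> \<phi> ` D \<and> P B F))"

definition has_reducible_reduct_subweb ::
    "nat \<Rightarrow> nat \<Rightarrow>
     ('m set \<times> ('m \<Rightarrow> ('r::finite, 'n::{finite, linorder}) coords) \<times> (('r, 'n) coords \<Rightarrow> real ^ 'r)) set \<Rightarrow> bool" where
  "has_reducible_reduct_subweb k l E \<longleftrightarrow> locally_representable (fibrewise_reducible_on k l) E"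

definition has_reducible_closed_form ::
    "nat \<Rightarrow> nat \<Rightarrow>
     ('m set \<times> ('m \<Rightarrow> ('r::finite, 'n::{finite, linorder}) coords) \<times> (('r, 'n) coords \<Rightarrow> real ^ 'r)) set \<Rightarrow> bool" where
  "has_reducible_closed_form k l E \<longleftrightarrow> locally_representable (jointly_reducible_on k l) E"


section \<open>Differential forms, adapted co-frames and the torsion tensor\<close>

text \<open>
  A (vector valued) 1-form is given by its local expressions: \<open>\<theta> c x v\<close> is the value at the point
  \<open>x\<close> on the tangent vector with components \<open>v\<close> in the chart \<open>c\<close>.
\<close>

type_synonym ('m, 'r, 'n, 'b) form = "('m, 'r, 'n) chart \<Rightarrow> 'm \<Rightarrow> ('r, 'n) coords \<Rightarrow> 'b"

definition one_form_on ::
    "('m, 'r::finite, 'n::finite) chart set \<Rightarrow> 'm set \<Rightarrow> ('m, 'r, 'n, 'b::euclidean_space) form \<Rightarrow> bool" where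
  "one_form_on A D \<theta> \<longleftrightarrow>
     (\<forall>c\<in>A. \<forall>x\<in>fst c \<inter> D. linear (\<theta> c x)) \<and>
     (\<forall>c\<in>A. \<forall>v. smooth_on (snd c ` (fst c \<inter> D)) (\<lambda>y. \<theta> c (chart_inv c y) v)) \<and>
     (\<forall>c\<in>A. \<forall>d\<in>A. \<forall>x\<in>fst c \<inter> fst d \<inter> D. \<forall>v. \<theta> c x v = \<theta> d x (differential c (snd d) x v))"

text \<open>
  Exterior derivative and exterior product, with the normalization
  \<open>d\<theta>(X,Y) = X \<theta>(Y) - Y \<theta>(X) - \<theta>([X,Y])\<close>; the arguments \<open>u\<close>, \<open>v\<close> extend to constant vector
  fields in the chart, which commute.
\<close>

definition ext_deriv ::
    "('m, 'r::finite, 'n::finite, real) form \<Rightarrow> ('m, 'r, 'n) chart \<Rightarrow> 'm \<Rightarrow>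
     ('r, 'n) coords \<Rightarrow> ('r, 'n) coords \<Rightarrow> real" where
  "ext_deriv \<theta> c x u v =
     frechet_derivative (\<lambda>y. \<theta> c (chart_inv c y) v) (at (snd c x)) u -
     frechet_derivative (\<lambda>y. \<theta> c (chart_inv c y) u) (at (snd c x)) v"

definition wedge ::
    "('m, 'r, 'n, real) form \<Rightarrow> ('m, 'r, 'n, real) form \<Rightarrow> ('m, 'r, 'n) chart \<Rightarrow> 'm \<Rightarrow>
     ('r, 'n) coords \<Rightarrow> ('r, 'n) coords \<Rightarrow> real" where
  "wedge \<theta> \<eta> c x u v = \<theta> c x u * \<eta> c x v - \<theta> c x v * \<eta> c x u"

definition form_comp :: "('m, 'r, 'n, real ^ 'r) form \<Rightarrow> 'r \<Rightarrow> ('m, 'r, 'n, real) form" where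
  "form_comp \<theta> i = (\<lambda>c x v. \<theta> c x v $ i)"

definition adapted_coframe ::
    "('m::topological_space, 'r::finite, 'n::finite) chart set \<Rightarrow> ('n option \<Rightarrow> ('m, 'r) foliation) \<Rightarrow>
     'm set \<Rightarrow> ('n option \<Rightarrow> ('m, 'r, 'n, real ^ 'r) form) \<Rightarrow> bool" where
  "adapted_coframe A W D \<omega> \<longleftrightarrow> open D \<and>
     (\<forall>\<xi>. one_form_on A D (\<omega> \<xi>)) \<and>
     (\<forall>\<xi>. \<forall>c\<in>A. \<forall>x\<in>fst c \<inter> D. {v. \<omega> \<xi> c x v = 0} = leaf_tangent (W \<xi>) c x) \<and>
     (\<forall>c\<in>A. \<forall>x\<in>fst c \<inter> D. \<forall>v. (\<Sum>\<alpha>\<in>UNIV. \<omega> (Some \<alpha>) c x v) + \<omega> None c x v = 0)"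

text \<open>
  \<open>a \<alpha> \<beta> i j m\<close> is the component with upper index \<open>i\<close> and lower indices \<open>j\<close>, \<open>m\<close>;
  the values for \<open>\<alpha> = \<beta>\<close> carry no meaning.  The form \<open>\<kappa> i j\<close> is the connection form with
  upper index \<open>i\<close> and lower index \<open>j\<close>.
\<close>

definition torsion_tensor ::
    "('m, 'r::finite, 'n::finite) chart set \<Rightarrow> 'm set \<Rightarrow> ('n option \<Rightarrow> ('m, 'r, 'n, real ^ 'r) form) \<Rightarrow>
     ('n \<Rightarrow> 'n \<Rightarrow> 'r \<Rightarrow> 'r \<Rightarrow> 'r \<Rightarrow> 'm \<Rightarrow> real) \<Rightarrow> bool" where
  "torsion_tensor A D \<omega> a \<longleftrightarrow>
     (\<forall>\<alpha> \<beta> i j m. \<alpha> \<noteq> \<beta> \<longrightarrow> smooth_map_on A D (a \<alpha> \<beta> i j m)) \<and>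
     (\<forall>\<alpha> \<beta> i j m. \<forall>x\<in>D. \<alpha> \<noteq> \<beta> \<longrightarrow> a \<alpha> \<beta> i j m x = a \<beta> \<alpha> i m j x) \<and>
     (\<forall>i j m. \<forall>x\<in>D. (\<Sum>\<alpha>\<in>UNIV. \<Sum>\<beta>\<in>- {\<alpha>}. a \<alpha> \<beta> i j m x) = 0) \<and>
     (\<exists>\<kappa> :: 'r \<Rightarrow> 'r \<Rightarrow> ('m, 'r, 'n, real) form.
        (\<forall>i j. one_form_on A D (\<kappa> i j)) \<and>
        (\<forall>\<alpha> i. \<forall>c\<in>A. \<forall>x\<in>fst c \<inter> D. \<forall>u v.
           ext_deriv (form_comp (\<omega> (Some \<alpha>)) i) c x u v =
             (\<Sum>j\<in>UNIV. wedge (form_comp (\<omega> (Some \<alpha>)) j) (\<kappa> i j) c x u v) +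
             (\<Sum>\<beta>\<in>- {\<alpha>}. \<Sum>j\<in>UNIV. \<Sum>m\<in>UNIV. a \<alpha> \<beta> i j m x *
                wedge (form_comp (\<omega> (Some \<alpha>)) j) (form_comp (\<omega> (Some \<beta>)) m) c x u v)))"


section \<open>Integrable distributions\<close>

type_synonym ('m, 'r, 'n) distribution = "('m, 'r, 'n) chart \<Rightarrow> 'm \<Rightarrow> ('r, 'n) coords set"

text \<open>
  \<open>N\<close> is an embedded submanifold (described by slice charts) whose tangent spaces are the planes
  of the distribution.
\<close>

definition integral_manifold ::
    "('m, 'r::finite, 'n::finite) chart set \<Rightarrow> ('m, 'r, 'n) distribution \<Rightarrow> 'm set \<Rightarrow> bool" where
  "integral_manifold A \<Delta> N \<longleftrightarrow>
     (\<forall>y\<in>N. \<exists>c\<in>A. \<exists>T. y \<in> fst c \<and> subspace T \<and>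
        snd c ` (fst c \<inter> N) = snd c ` fst c \<inter> (\<lambda>t. snd c y + t) ` T \<and>
        (\<forall>z\<in>fst c \<inter> N. \<Delta> c z = T))"

definition integrable_distribution ::
    "('m, 'r::finite, 'n::finite) chart set \<Rightarrow> 'm set \<Rightarrow> ('m, 'r, 'n) distribution \<Rightarrow> bool" where
  "integrable_distribution A D \<Delta> \<longleftrightarrow> (\<forall>x\<in>D. \<exists>N. x \<in> N \<and> N \<subseteq> D \<and> integral_manifold A \<Delta> N)"

definition reduct_distribution ::
    "nat \<Rightarrow> nat \<Rightarrow> ('n::{finite, linorder} option \<Rightarrow> ('m, 'r::finite, 'n, real ^ 'r) form) \<Rightarrow>
     ('m, 'r, 'n) distribution" where
  "reduct_distribution k l \<omega> c x =
     {v. (\<forall>\<sigma>\<in>idx_s k. \<omega> (Some \<sigma>) c x v = 0) \<and> (\<Sum>\<alpha>\<in>idx_a l k. \<omega> (Some \<alpha>) c x v) = 0}"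

end

theory Submission
  imports Defs
begin

text \<open>
  All four statements are compared with one first order condition on the function \<open>F\<close> of a closed
  form equation.  Write \<open>P\<close>, \<open>I\<close>, \<open>S\<close> for the index groups \<open>1, \<dots>, l\<close> and \<open>l+1, \<dots>, k\<close> and
  \<open>k+1, \<dots>, n\<close>, and \<open>D\<^sub>I F\<close> for the restriction of \<open>dF\<close> to vectors along the coordinates in \<open>I\<close>.  The
  condition \<open>kernel_stationary\<close> at a point says that a vector annihilated by \<open>D\<^sub>I F\<close> there stays
  annihilated, to first order, when the point moves along the coordinates in \<open>P\<close>.

  If \<open>F = f(x\<^sub>P, g(x\<^sub>I, c), c)\<close> on the slices \<open>x\<^sub>S = c\<close>, then \<open>D\<^sub>I F\<close> and \<open>dg\<close> have the same kernel,
  because the factor \<open>\<partial>f/\<partial>g\<close> is invertible; and \<open>dg\<close> does not depend on \<open>x\<^sub>P\<close>.  So the fibrewise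
  representation already forces the condition (\<open>kernel_stationary_if_fibrewise_reducible\<close>).

  Conversely, the condition on a convex domain makes the kernel of \<open>D\<^sub>I F\<close> constant along \<open>P\<close>
  (\<open>kernel_constant\<close>).  It is therefore the kernel of \<open>dg\<close> for the function \<open>g\<close> obtained from \<open>F\<close> by
  freezing \<open>x\<^sub>P\<close> at a base point.  This explicit \<open>g\<close> does the work of the Frobenius theorem: by the
  inverse function theorem it can replace one of the coordinates in \<open>I\<close> (\<open>straightening\<close>), and in
  the new coordinates \<open>F\<close> no longer depends on the other coordinates in \<open>I\<close>, which is the joint
  representation (\<open>jointly_reducible_if_kernel_stationary\<close>), while the distribution is the one tangent
  to the coordinate slices \<open>x\<^sub>S = const\<close>, \<open>g = const\<close> (\<open>integrable_if_kernel_stationary\<close>).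

  The torsion enters through the form \<open>\<Theta> = \<Sum>\<^sub>\<alpha>\<^sub>\<in>\<^sub>I \<omega>\<^sub>\<alpha>\<close>.  When \<open>u\<close> is annihilated by all forms but
  \<open>\<omega>\<^sub>p\<close>, and \<open>v\<close> by \<open>\<Theta>\<close> and all \<open>\<omega>\<^sub>\<beta>\<close> with \<open>\<beta> \<notin> I\<close>, the structure equations reduce \<open>d\<Theta>(u,v)\<close> to the
  terms with \<open>a\<^sub>\<alpha>\<^sub>p\<close>, and these cancel for all such \<open>u\<close>, \<open>v\<close> exactly if \<open>a\<^sub>p\<^sub>\<alpha>\<close> is the same for all
  \<open>\<alpha> \<in> I\<close> (\<open>torsion_condition_iff_ext_deriv\<close>).  In the coordinates of the closed form equation, \<open>\<Theta>\<close> is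
  \<open>D\<^sub>I F\<close> up to an invertible factor, so the vanishing of \<open>d\<Theta>(u,v)\<close> is the condition above
  (\<open>kernel_stationary_iff_torsion_condition\<close>).  On an integral manifold of the distribution \<open>\<Theta>\<close>
  vanishes on tangent vectors, hence \<open>d\<Theta>\<close> vanishes on pairs of them
  (\<open>torsion_condition_if_integrable\<close>).
\<close>


section \<open>Calculus of smooth maps\<close>

lemma Ck_on_subset: "Ck_on n T f \<Longrightarrow> S \<subseteq> T \<Longrightarrow> Ck_on n S f"
  by (induction n arbitrary: f) (auto intro: continuous_on_subset)

lemma Ck_on_cong:
  assumes "open S" "\<And>x. x \<in> S \<Longrightarrow> f x = g x"
  shows "Ck_on n S f \<longleftrightarrow> Ck_on n S g"
  using assms(2)
proof (induction n arbitrary: f g)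
  case 0
  then show ?case by (simp cong: continuous_on_cong)
next
  case (Suc n)
  have diff: "g' differentiable at x"
    if "f' differentiable at x" "x \<in> S" "\<And>x. x \<in> S \<Longrightarrow> f' x = g' x" for f' g' :: "'a \<Rightarrow> 'b" and x
    using that \<open>open S\<close> unfolding differentiable_def
    by (meson has_derivative_transform_within_open)
  have "frechet_derivative f (at x) = frechet_derivative g (at x)"
    if "f differentiable at x" "x \<in> S" for x
    using frechet_derivative_transform_within_open[OF that(1) assms(1) that(2)] Suc.prems by blast
  then have "Ck_on n S (\<lambda>x. frechet_derivative f (at x) v) \<longleftrightarrow> Ck_on n S (\<lambda>x. frechet_derivative g (at x) v)"
    if "\<And>x. x \<in> S \<Longrightarrow> f differentiable at x" for v
    using that by (intro Suc.IH) auto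
  moreover have "(\<forall>x\<in>S. f differentiable at x) \<longleftrightarrow> (\<forall>x\<in>S. g differentiable at x)"
    using diff[of f _ g] diff[of g _ f] Suc.prems by auto
  ultimately show ?case by auto
qed

lemma Ck_on_Suc_derivative:
  assumes "open S" "\<And>x. x \<in> S \<Longrightarrow> (f has_derivative f' x) (at x)"
  shows "Ck_on (Suc n) S f \<longleftrightarrow> (\<forall>v. Ck_on n S (\<lambda>x. f' x v))"
proof -
  have "Ck_on n S (\<lambda>x. frechet_derivative f (at x) v) \<longleftrightarrow> Ck_on n S (\<lambda>x. f' x v)" for v
    using assms frechet_derivative_at by (intro Ck_on_cong) fastforce+
  then show ?thesis using assms(2) by (auto simp: differentiable_def)
qed

lemma Ck_on_Suc_has_derivative:
  assumes "Ck_on (Suc n) S f" "x \<in> S"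
  shows "(f has_derivative frechet_derivative f (at x)) (at x)"
  using assms by (simp add: frechet_derivative_works)

lemma Ck_on_SucD: "Ck_on (Suc n) S f \<Longrightarrow> Ck_on n S f"
proof (induction n arbitrary: f)
  case 0
  then show ?case
    by (auto intro!: continuous_at_imp_continuous_on differentiable_imp_continuous_within)
next
  case (Suc n)
  then show ?case by (metis Ck_on.simps(2))
qed

lemma Ck_on_const: "Ck_on n S (\<lambda>_. c)"
  by (induction n arbitrary: c) auto

lemma Ck_on_bounded_linear:
  assumes "open S" "bounded_linear h" shows "Ck_on n S h"
proof (cases n)
  case 0
  then show ?thesis by (simp add: assms(2) linear_continuous_on)
next
  case (Suc m)
  then show ?thesis
    using assms Ck_on_Suc_derivative[of S h "\<lambda>_. h" m]
    by (simp add: bounded_linear_imp_has_derivative Ck_on_const)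
qed

lemma Ck_on_bounded_linear_comp:
  assumes "open S" "bounded_linear h" "Ck_on n S f"
  shows "Ck_on n S (\<lambda>x. h (f x))"
  using assms(3)
proof (induction n arbitrary: f)
  case 0
  then show ?case using assms(2) by (simp add: bounded_linear.continuous_on)
next
  case (Suc n)
  have "((\<lambda>x. h (f x)) has_derivative (\<lambda>v. h (frechet_derivative f (at x) v))) (at x)" if "x \<in> S" for x
    using assms(2) Ck_on_Suc_has_derivative[OF Suc.prems that] by (rule bounded_linear.has_derivative)
  then show ?case
    using Suc by (subst Ck_on_Suc_derivative[OF assms(1)]) auto
qed

lemma Ck_on_add:
  assumes "open S" "Ck_on n S f" "Ck_on n S g"
  shows "Ck_on n S (\<lambda>x. f x + g x)"
  using assms(2,3)
proof (induction n arbitrary: f g)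
  case 0
  then show ?case by (simp add: continuous_on_add)
next
  case (Suc n)
  have "((\<lambda>x. f x + g x) has_derivative
      (\<lambda>v. frechet_derivative f (at x) v + frechet_derivative g (at x) v)) (at x)" if "x \<in> S" for x
    using Suc.prems that by (intro has_derivative_add Ck_on_Suc_has_derivative)
  then show ?case
    using Suc by (subst Ck_on_Suc_derivative[OF assms(1)]) auto
qed

lemma Ck_on_sum:
  assumes "open S" "\<And>i. i \<in> I \<Longrightarrow> Ck_on n S (f i)"
  shows "Ck_on n S (\<lambda>x. \<Sum>i\<in>I. f i x)"
  using assms(2)
  by (induction I rule: infinite_finite_induct) (auto simp: Ck_on_const intro: Ck_on_add assms(1))

lemma Ck_on_bilinear:
  assumes "open S" "bounded_bilinear pr" "Ck_on n S f" "Ck_on n S g"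
  shows "Ck_on n S (\<lambda>x. pr (f x) (g x))"
  using assms(3,4)
proof (induction n arbitrary: f g)
  case 0
  then show ?case using assms(2) by (simp add: bounded_bilinear.continuous_on)
next
  case (Suc n)
  have "((\<lambda>x. pr (f x) (g x)) has_derivative
      (\<lambda>v. pr (f x) (frechet_derivative g (at x) v) + pr (frechet_derivative f (at x) v) (g x))) (at x)"
    if "x \<in> S" for x
    using Suc.prems that by (intro bounded_bilinear.FDERIV[OF assms(2)] Ck_on_Suc_has_derivative)
  moreover have "Ck_on n S f" "Ck_on n S g"
    using Suc.prems Ck_on_SucD by blast+
  ultimately show ?case
    using Suc by (subst Ck_on_Suc_derivative[OF assms(1)]) (auto intro!: Ck_on_add assms(1))
qed

lemma Ck_on_inverse:
  fixes f :: "'a::euclidean_space \<Rightarrow> real"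
  assumes "open S" "Ck_on n S f" "\<And>x. x \<in> S \<Longrightarrow> f x \<noteq> 0"
  shows "Ck_on n S (\<lambda>x. inverse (f x))"
  using assms(2)
proof (induction n)
  case 0
  then show ?case using assms(3) by (simp add: continuous_on_inverse)
next
  case (Suc n)
  have "((\<lambda>x. inverse (f x)) has_derivative
      (\<lambda>v. - (inverse (f x) * frechet_derivative f (at x) v * inverse (f x)))) (at x)"
    if "x \<in> S" for x
    using Suc.prems that assms(3) by (intro Deriv.has_derivative_inverse Ck_on_Suc_has_derivative)
  moreover have "Ck_on n S (\<lambda>x. - (inverse (f x) * frechet_derivative f (at x) v * inverse (f x)))" for v
    using Suc Ck_on_SucD[OF Suc.prems]
    by (intro Ck_on_bounded_linear_comp[where h = uminus] Ck_on_bilinear[where pr = "(*)"]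
        bounded_bilinear_mult assms(1) bounded_linear_minus bounded_linear_ident) auto
  ultimately show ?case
    by (subst Ck_on_Suc_derivative[OF assms(1)]) auto
qed

lemma frechet_derivative_expand:
  assumes "f differentiable at x"
  shows "frechet_derivative f (at x) v = (\<Sum>b\<in>Basis. (v \<bullet> b) *\<^sub>R frechet_derivative f (at x) b)"
proof -
  interpret linear "frechet_derivative f (at x)"
    using assms by (rule linear_frechet_derivative)
  have "frechet_derivative f (at x) (\<Sum>b\<in>Basis. (v \<bullet> b) *\<^sub>R b)
      = (\<Sum>b\<in>Basis. (v \<bullet> b) *\<^sub>R frechet_derivative f (at x) b)"
    by (simp add: sum scale)
  then show ?thesis by (simp add: euclidean_representation)
qed

text \<open>
  The derivative of a composite applied to a fixed vector is not itself a composite, because the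
  direction moves with the point; expanding that direction in the basis makes it a finite sum of
  products, to which the induction hypothesis applies.
\<close>

lemma Ck_on_compose:
  assumes "open S" "open T" "g ` S \<subseteq> T" "Ck_on n S g" "Ck_on n T f"
  shows "Ck_on n S (\<lambda>x. f (g x))"
  using assms(4,5)
proof (induction n arbitrary: f)
  case 0
  then show ?case using assms(3) by (auto intro: continuous_on_compose2)
next
  case (Suc n)
  let ?f' = "\<lambda>y. frechet_derivative f (at y)" and ?g' = "\<lambda>x. frechet_derivative g (at x)"
  have "((\<lambda>x. f (g x)) has_derivative (\<lambda>v. \<Sum>b\<in>Basis. (?g' x v \<bullet> b) *\<^sub>R ?f' (g x) b)) (at x)"
    if "x \<in> S" for x
  proof -
    have gx: "g x \<in> T" using that assms(3) by auto
    have "f differentiable at (g x)" using Suc.prems(2) gx by simp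
    then have "(\<lambda>v. ?f' (g x) (?g' x v)) = (\<lambda>v. \<Sum>b\<in>Basis. (?g' x v \<bullet> b) *\<^sub>R ?f' (g x) b)"
      using frechet_derivative_expand by blast
    moreover have "((\<lambda>x. f (g x)) has_derivative (\<lambda>v. ?f' (g x) (?g' x v))) (at x)"
      by (rule has_derivative_compose[OF Ck_on_Suc_has_derivative[OF Suc.prems(1) that]
            Ck_on_Suc_has_derivative[OF Suc.prems(2) gx]])
    ultimately show ?thesis by simp
  qed
  moreover have "Ck_on n S (\<lambda>x. ?f' (g x) b)" for b
    using Suc.IH[of "\<lambda>y. ?f' y b"] Suc.prems Ck_on_SucD[OF Suc.prems(1)] by simp
  then have "Ck_on n S (\<lambda>x. \<Sum>b\<in>Basis. (?g' x v \<bullet> b) *\<^sub>R ?f' (g x) b)" for v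
    using Suc.prems
    by (intro Ck_on_sum assms(1) Ck_on_bilinear[where pr = "(*\<^sub>R)"] bounded_bilinear_scaleR
        Ck_on_bounded_linear_comp[where h = "\<lambda>y. y \<bullet> _"] bounded_linear_inner_left) auto
  ultimately show ?case
    by (subst Ck_on_Suc_derivative[OF assms(1)]) auto
qed

lemma smooth_on_subset: "smooth_on T f \<Longrightarrow> S \<subseteq> T \<Longrightarrow> smooth_on S f"
  unfolding smooth_on_def using Ck_on_subset by blast

lemma smooth_on_cong:
  "open S \<Longrightarrow> (\<And>x. x \<in> S \<Longrightarrow> f x = g x) \<Longrightarrow> smooth_on S f \<longleftrightarrow> smooth_on S g"
  unfolding smooth_on_def using Ck_on_cong by blast

lemma smooth_on_has_derivative:
  "smooth_on S f \<Longrightarrow> x \<in> S \<Longrightarrow> (f has_derivative frechet_derivative f (at x)) (at x)"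
  unfolding smooth_on_def using Ck_on_Suc_has_derivative by blast

lemma smooth_on_derivative: "smooth_on S f \<Longrightarrow> smooth_on S (\<lambda>x. frechet_derivative f (at x) v)"
  unfolding smooth_on_def using Ck_on.simps(2) by blast

lemma smooth_on_continuous: "smooth_on S f \<Longrightarrow> continuous_on S f"
  unfolding smooth_on_def using Ck_on.simps(1) by blast

lemma smooth_on_const: "smooth_on S (\<lambda>_. c)"
  unfolding smooth_on_def by (simp add: Ck_on_const)

lemma smooth_on_bounded_linear: "open S \<Longrightarrow> bounded_linear h \<Longrightarrow> smooth_on S h"
  unfolding smooth_on_def by (simp add: Ck_on_bounded_linear)

lemma smooth_on_bounded_linear_comp:
  "open S \<Longrightarrow> bounded_linear h \<Longrightarrow> smooth_on S f \<Longrightarrow> smooth_on S (\<lambda>x. h (f x))"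
  unfolding smooth_on_def by (simp add: Ck_on_bounded_linear_comp)

lemma smooth_on_add:
  "open S \<Longrightarrow> smooth_on S f \<Longrightarrow> smooth_on S g \<Longrightarrow> smooth_on S (\<lambda>x. f x + g x)"
  unfolding smooth_on_def by (simp add: Ck_on_add)

lemma smooth_on_diff:
  "open S \<Longrightarrow> smooth_on S f \<Longrightarrow> smooth_on S g \<Longrightarrow> smooth_on S (\<lambda>x. f x - g x)"
  using smooth_on_add[of S f "\<lambda>x. - g x"]
  by (simp add: smooth_on_bounded_linear_comp bounded_linear_minus bounded_linear_ident)

lemma smooth_on_sum:
  "open S \<Longrightarrow> (\<And>i. i \<in> I \<Longrightarrow> smooth_on S (f i)) \<Longrightarrow> smooth_on S (\<lambda>x. \<Sum>i\<in>I. f i x)"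
  unfolding smooth_on_def by (simp add: Ck_on_sum)

lemma smooth_on_bilinear:
  "open S \<Longrightarrow> bounded_bilinear pr \<Longrightarrow> smooth_on S f \<Longrightarrow> smooth_on S g
    \<Longrightarrow> smooth_on S (\<lambda>x. pr (f x) (g x))"
  unfolding smooth_on_def by (simp add: Ck_on_bilinear)

lemmas smooth_on_mult = smooth_on_bilinear[OF _ bounded_bilinear_mult]
lemmas smooth_on_scaleR = smooth_on_bilinear[OF _ bounded_bilinear_scaleR]

lemma smooth_on_inverse:
  fixes f :: "'a::euclidean_space \<Rightarrow> real"
  shows "open S \<Longrightarrow> smooth_on S f \<Longrightarrow> (\<And>x. x \<in> S \<Longrightarrow> f x \<noteq> 0) \<Longrightarrow> smooth_on S (\<lambda>x. inverse (f x))"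
  unfolding smooth_on_def by (simp add: Ck_on_inverse)

lemma smooth_on_compose:
  "open S \<Longrightarrow> open T \<Longrightarrow> g ` S \<subseteq> T \<Longrightarrow> smooth_on S g \<Longrightarrow> smooth_on T f \<Longrightarrow> smooth_on S (\<lambda>x. f (g x))"
  unfolding smooth_on_def using Ck_on_compose by blast

lemma smooth_on_prod:
  fixes f :: "'i \<Rightarrow> 'a::euclidean_space \<Rightarrow> real"
  assumes "open S" "\<And>i. i \<in> I \<Longrightarrow> smooth_on S (f i)"
  shows "smooth_on S (\<lambda>x. \<Prod>i\<in>I. f i x)"
  using assms(2)
  by (induction I rule: infinite_finite_induct) (auto simp: smooth_on_const intro: smooth_on_mult assms(1))

lemma smooth_on_componentwise:
  assumes "open S" "\<And>b. b \<in> Basis \<Longrightarrow> smooth_on S (\<lambda>x. f x \<bullet> b)"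
  shows "smooth_on S f"
proof -
  have "smooth_on S (\<lambda>x. \<Sum>b\<in>Basis. (f x \<bullet> b) *\<^sub>R b)"
    using assms by (intro smooth_on_sum smooth_on_scaleR smooth_on_const)
  then show ?thesis by (simp add: euclidean_representation)
qed

lemma smooth_on_vec_lambda:
  fixes f :: "'a::euclidean_space \<Rightarrow> 'b::euclidean_space ^ 'i::finite"
  assumes "open S" "\<And>i. smooth_on S (\<lambda>x. f x $ i)"
  shows "smooth_on S f"
proof (rule smooth_on_componentwise[OF assms(1)])
  fix b :: "'b ^ 'i" assume "b \<in> Basis"
  then obtain i u where "b = axis i u" "u \<in> Basis" by (auto simp: Basis_vec_def)
  then show "smooth_on S (\<lambda>x. f x \<bullet> b)"
    using smooth_on_bounded_linear_comp[OF assms(1) bounded_linear_inner_left assms(2)[of i], of u]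
    by (simp add: inner_axis)
qed

lemma smooth_on_nth: "open S \<Longrightarrow> smooth_on S f \<Longrightarrow> smooth_on S (\<lambda>x. f x $ i)"
  using smooth_on_bounded_linear_comp[OF _ bounded_linear_vec_nth] .

lemma smooth_on_det:
  fixes G :: "'a::euclidean_space \<Rightarrow> real ^ 'i::finite ^ 'i"
  assumes "open S" "\<And>i j. smooth_on S (\<lambda>x. G x $ i $ j)"
  shows "smooth_on S (\<lambda>x. det (G x))"
  unfolding det_def using assms by (intro smooth_on_sum smooth_on_mult smooth_on_const smooth_on_prod)

text \<open>Cramer's rule expresses the solution rationally in the data, hence smoothly.\<close>

definition linear_solve :: "real ^ 'i ^ 'i \<Rightarrow> real ^ 'i \<Rightarrow> real ^ 'i::finite" where
  "linear_solve G b = (\<chi> k. det (\<chi> i j. if j = k then b $ i else G $ i $ j) / det G)"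

lemma linear_solve_iff: "det G \<noteq> 0 \<Longrightarrow> G *v x = b \<longleftrightarrow> x = linear_solve G b"
  unfolding linear_solve_def by (rule cramer)

lemma mult_linear_solve: "det G \<noteq> 0 \<Longrightarrow> G *v linear_solve G b = b"
  using linear_solve_iff by blast

lemma linear_solve_mult: "det G \<noteq> 0 \<Longrightarrow> linear_solve G (G *v x) = x"
  using linear_solve_iff by metis

lemma smooth_on_linear_solve:
  fixes G :: "'a::euclidean_space \<Rightarrow> real ^ 'i::finite ^ 'i"
  assumes "open S" "\<And>i j. smooth_on S (\<lambda>x. G x $ i $ j)" "smooth_on S b" "\<And>x. x \<in> S \<Longrightarrow> det (G x) \<noteq> 0"
  shows "smooth_on S (\<lambda>x. linear_solve (G x) (b x))"
proof (rule smooth_on_vec_lambda[OF assms(1)])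
  fix k
  have "smooth_on S (\<lambda>x. det (\<chi> i j. if j = k then b x $ i else G x $ i $ j) * inverse (det (G x)))"
  proof (intro smooth_on_mult smooth_on_det smooth_on_inverse assms(1))
    show "smooth_on S (\<lambda>x. (\<chi> i j. if j = k then b x $ i else G x $ i $ j) $ i $ j)" for i j
      using assms by (cases "j = k") (auto intro: smooth_on_nth)
  qed (use assms in auto)
  then show "smooth_on S (\<lambda>x. linear_solve (G x) (b x) $ k)"
    by (simp add: linear_solve_def divide_inverse)
qed

text \<open>
  Bootstrapping: the derivative of \<open>h\<close> is a smooth function of the value of \<open>h\<close>, so each order of
  differentiability of \<open>h\<close> yields the next one.
\<close>

lemma smooth_on_local_inverse:
  fixes \<psi> :: "'a::euclidean_space \<Rightarrow> 'a"
  assumes "open V" "open U" "h ` V \<subseteq> U"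
    and deriv: "\<And>y. y \<in> V \<Longrightarrow> (h has_derivative J (h y)) (at y)"
    and smooth: "\<And>w. smooth_on U (\<lambda>x. J x w)"
  shows "smooth_on V h"
proof -
  have "Ck_on n V h" for n
  proof (induction n)
    case 0
    then show ?case
      using deriv by (auto intro!: continuous_at_imp_continuous_on has_derivative_continuous)
  next
    case (Suc n)
    have "Ck_on n V (\<lambda>y. J (h y) w)" for w
      using Ck_on_compose[OF assms(1-3) Suc] smooth[of w] unfolding smooth_on_def by blast
    then show ?case by (subst Ck_on_Suc_derivative[OF assms(1) deriv]) auto
  qed
  then show ?thesis by (simp add: smooth_on_def)
qed

lemma smooth_near_open: "open T \<Longrightarrow> smooth_on T f \<Longrightarrow> smooth_near T f"
  unfolding smooth_near_def by blast

lemma smooth_near_compose: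
  assumes "smooth_near Y f" "m ` X \<subseteq> Y" "smooth_on UNIV m"
  shows "smooth_near X (\<lambda>x. f (m x))"
proof -
  obtain T where T: "open T" "Y \<subseteq> T" "smooth_on T f" using assms(1) smooth_near_def by blast
  have "open (m -` T)"
    using T(1) smooth_on_continuous[OF assms(3)] by (rule open_vimage)
  moreover from this have "smooth_on (m -` T) (\<lambda>x. f (m x))"
    by (rule smooth_on_compose[of _ T m]) (use T smooth_on_subset[OF assms(3)] in auto)
  ultimately show ?thesis
    unfolding smooth_near_def using T(2) assms(2) by blast
qed

lemma smooth_on_affine: "bounded_linear L \<Longrightarrow> smooth_on UNIV (\<lambda>x. b + L x)"
  by (intro smooth_on_add smooth_on_const) (auto intro: smooth_on_bounded_linear)

lemma linear_smooth_derivative: "smooth_on S f \<Longrightarrow> x \<in> S \<Longrightarrow> linear (frechet_derivative f (at x))"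
  using smooth_on_has_derivative has_derivative_linear by blast

lemma bounded_bilinear_matrix_vector_mult:
  "bounded_bilinear ((*v) :: real ^ 'i::finite ^ 'j::finite \<Rightarrow> _)"
  unfolding bilinear_conv_bounded_bilinear[symmetric] bilinear_def
  by (auto intro!: linearI simp: algebra_simps matrix_vector_mult_add_rdistrib scaleR_matrix_vector_assoc
      matrix_vector_mult_scaleR)

text \<open>
  The derivative of the matrix does not contribute at a zero of the vector.  This is why an
  invertible factor is harmless in all comparisons of kernels below.
\<close>

lemma derivative_matrix_mult_at_zero:
  fixes M :: "'a::euclidean_space \<Rightarrow> real ^ 'i::finite ^ 'j::finite"
  assumes "M differentiable at x" "(w has_derivative w') (at x)" "w x = 0"
  shows "((\<lambda>y. M y *v w y) has_derivative (\<lambda>u. M x *v w' u)) (at x)"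
  using bounded_bilinear.FDERIV[OF bounded_bilinear_matrix_vector_mult
      assms(1)[unfolded frechet_derivative_works] assms(2)] assms(3)
  by (simp add: matrix_vector_mult_0_right)

lemma constant_along_segment:
  assumes "convex C" "x \<in> C" "y \<in> C"
    and "\<And>z. z \<in> C \<Longrightarrow> (f has_derivative f' z) (at z)" "\<And>z. z \<in> C \<Longrightarrow> f' z (y - x) = 0"
  shows "f x = f y"
proof -
  let ?s = "\<lambda>t::real. x + t *\<^sub>R (y - x)"
  have in_C: "?s t \<in> C" if "t \<in> {0..1}" for t
    using convexD_alt[OF assms(1-3), of t] that by (simp add: algebra_simps)
  have "((\<lambda>t. f (?s t)) has_derivative (\<lambda>h. f' (?s t) (h *\<^sub>R (y - x)))) (at t within {0..1})"
    if "t \<in> {0..1}" for t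
    by (rule has_derivative_compose[of ?s, OF _ assms(4)[OF in_C[OF that]]])
      (auto intro!: derivative_eq_intros)
  moreover have "f' (?s t) (h *\<^sub>R (y - x)) = 0" if "t \<in> {0..1}" for h t
    using assms(4)[OF in_C[OF that]] assms(5)[OF in_C[OF that]]
    by (simp add: linear_cmul[OF has_derivative_linear])
  ultimately have "\<exists>c. \<forall>t\<in>{0..1}. f (?s t) = c"
    by (intro has_derivative_zero_constant) auto
  then obtain c where c: "\<forall>t\<in>{0..1}. f (?s t) = c" by blast
  then show ?thesis using c[rule_format, of 0] c[rule_format, of 1] by simp
qed

lemma derivative_zero_along_line:
  assumes "(f has_derivative f') (at x)" "open N" "x \<in> N"
    and "\<And>t. x + t *\<^sub>R u \<in> N \<Longrightarrow> f (x + t *\<^sub>R u) = 0"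
  shows "f' u = 0"
proof -
  have "((\<lambda>t. f (x + t *\<^sub>R u)) has_derivative (\<lambda>h. f' (h *\<^sub>R u))) (at 0)"
    by (rule has_derivative_compose[of "\<lambda>t. x + t *\<^sub>R u" "\<lambda>h. h *\<^sub>R u"])
      (use assms(1) in \<open>auto intro!: derivative_eq_intros\<close>)
  moreover have "open ((\<lambda>t. x + t *\<^sub>R u) -` N)"
    using assms(2) by (intro open_vimage) (auto intro!: continuous_intros)
  ultimately have "((\<lambda>t. 0) has_derivative (\<lambda>h. f' (h *\<^sub>R u))) (at (0 :: real))"
    by (rule has_derivative_transform_within_open) (use assms in auto)
  then have "(\<lambda>h :: real. f' (h *\<^sub>R u)) = (\<lambda>h. 0)"
    by (rule has_derivative_unique) (rule has_derivative_const)
  then show ?thesis by (metis scaleR_one)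
qed


section \<open>Blocks of coordinates\<close>

lemma block_nth [simp]: "block I x $ \<alpha> = (if \<alpha> \<in> I then x $ \<alpha> else 0)"
  by (simp add: block_def)

lemma bounded_linear_block [simp]: "bounded_linear (block I)"
  by (intro linear_conv_bounded_linear[THEN iffD1] linearI) (auto simp: vec_eq_iff)

lemma bounded_linear_axis [simp]: "bounded_linear (\<lambda>h :: 'b::euclidean_space. axis \<alpha> h :: 'b ^ 'n::finite)"
  by (intro linear_conv_bounded_linear[THEN iffD1] linearI) (auto simp: vec_eq_iff axis_def)

lemma axis_nth_if: "axis \<alpha> h $ \<beta> = (if \<beta> = \<alpha> then h else 0)"
  by (simp add: axis_def)

lemma block_add: "block I (x + y) = block I x + block I y"
  by (simp add: vec_eq_iff)

lemma block_scaleR: "block I (c *\<^sub>R x) = c *\<^sub>R block I x"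
  by (simp add: vec_eq_iff)

lemma block_block: "block I (block J x) = block (I \<inter> J) x"
  by (simp add: vec_eq_iff)

lemma block_empty: "block {} x = 0"
  by (simp add: vec_eq_iff)

lemma block_axis: "block I (axis \<alpha> h) = (if \<alpha> \<in> I then axis \<alpha> h else 0)"
  by (simp add: vec_eq_iff axis_nth_if)

lemma block_eq_sum_axis: "block I x = (\<Sum>\<alpha>\<in>I. axis \<alpha> (x $ \<alpha>))"
  by (auto simp: vec_eq_iff sum_component axis_nth_if)

lemma open_product_domain:
  assumes "\<And>\<alpha>. open (B \<alpha>)" shows "open (product_domain B)"
proof -
  have "product_domain B = (\<Inter>\<alpha>. (\<lambda>x. x $ \<alpha>) -` B \<alpha>)"
    by (auto simp: product_domain_def)
  then show ?thesis using assms by (simp add: open_INT open_vimage_vec_nth)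
qed

lemma product_domain_of_balls_subset:
  fixes x :: "('r::finite, 'n::finite) coords"
  assumes "open U" "x \<in> U"
  obtains \<delta> where "0 < \<delta>" "product_domain (\<lambda>\<alpha>. ball (x $ \<alpha>) \<delta>) \<subseteq> U"
proof -
  obtain e where e: "0 < e" "ball x e \<subseteq> U" using assms openE by blast
  let ?d = "e / CARD('n)"
  have "dist x y < e" if "y \<in> product_domain (\<lambda>\<alpha>. ball (x $ \<alpha>) ?d)" for y
  proof -
    have "dist x y \<le> (\<Sum>\<alpha>\<in>UNIV. dist (x $ \<alpha>) (y $ \<alpha>))"
      unfolding dist_vec_def by (rule L2_set_le_sum) simp
    also have "\<dots> < (\<Sum>\<alpha>\<in>(UNIV :: 'n set). ?d)"
      using that by (intro sum_strict_mono) (auto simp: product_domain_def)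
    finally show ?thesis by simp
  qed
  then show ?thesis using e that[of ?d] by (auto simp: subset_iff)
qed

lemma convex_product_domain: "(\<And>\<alpha>. convex (B \<alpha>)) \<Longrightarrow> convex (product_domain B)"
  unfolding product_domain_def convex_def by auto

definition freeze :: "'n set \<Rightarrow> ('r::finite, 'n::finite) coords \<Rightarrow> ('r, 'n) coords \<Rightarrow> ('r, 'n) coords" where
  "freeze P y x = block P y + block (- P) x"

lemma freeze_nth [simp]: "freeze P y x $ \<beta> = (if \<beta> \<in> P then y $ \<beta> else x $ \<beta>)"
  by (simp add: freeze_def)

lemma freeze_has_derivative: "(freeze P y has_derivative block (- P)) (at x)"
  unfolding freeze_def[abs_def]
  using has_derivative_add[OF has_derivative_const bounded_linear_imp_has_derivative[OF bounded_linear_block]]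
  by fastforce

lemma smooth_on_freeze: "open S \<Longrightarrow> smooth_on S (freeze P y)"
  unfolding freeze_def[abs_def]
  by (intro smooth_on_add smooth_on_const) (auto intro: smooth_on_bounded_linear)

lemma freeze_in_product_domain:
  "x \<in> product_domain B \<Longrightarrow> y \<in> product_domain B \<Longrightarrow> freeze P y x \<in> product_domain B"
  by (auto simp: product_domain_def)

lemma index_groups:
  fixes P I S :: "'n::{finite, linorder} set"
  fixes l k :: nat
  defines "P \<equiv> idx_p l" and "I \<equiv> idx_a l k" and "S \<equiv> idx_s k"
  assumes "l < k"
  shows "P \<union> I \<union> S = UNIV" "P \<inter> I = {}" "P \<inter> S = {}" "I \<inter> S = {}"
  using assms(4) by (auto simp: P_def I_def S_def idx_p_def idx_a_def idx_s_def)

lemma partial_jacobian_mult: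
  assumes "F differentiable at x"
  shows "partial_jacobian F \<alpha> x *v h = frechet_derivative F (at x) (axis \<alpha> h)"
proof -
  have "linear (\<lambda>h. frechet_derivative F (at x) (axis \<alpha> h))"
    using linear_compose[OF bounded_linear.linear[OF bounded_linear_axis] linear_frechet_derivative[OF assms]]
    by (simp add: o_def)
  then show ?thesis
    unfolding partial_jacobian_def using matrix_vector_mul by metis
qed

lemma partial_jacobian_nth:
  "partial_jacobian F \<alpha> x $ i $ j = frechet_derivative F (at x) (axis \<alpha> (axis j 1)) $ i"
  by (simp add: partial_jacobian_def matrix_def)

lemma smooth_on_partial_jacobian:
  "open S \<Longrightarrow> smooth_on S F \<Longrightarrow> smooth_on S (partial_jacobian F \<alpha>)"
  by (intro smooth_on_vec_lambda) (auto simp: partial_jacobian_nth intro: smooth_on_nth smooth_on_derivative)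


section \<open>Replacing one block of coordinates by a function\<close>

definition replace_coord ::
    "'n \<Rightarrow> (('r::finite, 'n::finite) coords \<Rightarrow> real ^ 'r) \<Rightarrow> ('r, 'n) coords \<Rightarrow> ('r, 'n) coords" where
  "replace_coord \<alpha> g x = block (- {\<alpha>}) x + axis \<alpha> (g x)"

lemma replace_coord_nth [simp]: "replace_coord \<alpha> g x $ \<beta> = (if \<beta> = \<alpha> then g x else x $ \<beta>)"
  by (simp add: replace_coord_def axis_nth_if)

lemma smooth_on_replace_coord:
  assumes "open U" "smooth_on U g" shows "smooth_on U (replace_coord \<alpha> g)"
  unfolding replace_coord_def
  using assms smooth_on_bounded_linear_comp[OF assms(1) bounded_linear_axis assms(2)]
  by (intro smooth_on_add) (auto intro: smooth_on_bounded_linear)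

lemma replace_coord_has_derivative:
  assumes "(g has_derivative g') (at x)"
  shows "(replace_coord \<alpha> g has_derivative replace_coord \<alpha> g') (at x)"
  unfolding replace_coord_def[abs_def]
  by (intro has_derivative_add bounded_linear_imp_has_derivative
      bounded_linear.has_derivative[OF bounded_linear_axis] assms bounded_linear_block)

text \<open>
  The derivative of the replacement is block triangular, with the partial Jacobian as its only
  non-trivial diagonal block; so the inverse function theorem applies as soon as that block is
  invertible, and Cramer's rule for it makes the inverse smooth.
\<close>

lemma replace_coord_local_diffeomorphism:
  fixes g :: "('r::finite, 'n::finite) coords \<Rightarrow> real ^ 'r"
  assumes "open U" "smooth_on U g" "\<And>x. x \<in> U \<Longrightarrow> det (partial_jacobian g \<alpha> x) \<noteq> 0" "x0 \<in> U"
  obtains U' V h where "open U'" "U' \<subseteq> U" "x0 \<in> U'" "open V"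
    "homeomorphism U' V (replace_coord \<alpha> g) h" "smooth_on V h"
    "\<And>y w. y \<in> V \<Longrightarrow> replace_coord \<alpha> (frechet_derivative g (at (h y))) (frechet_derivative h (at y) w) = w"
proof -
  let ?g' = "\<lambda>x. frechet_derivative g (at x)"
  let ?\<psi>' = "\<lambda>x. replace_coord \<alpha> (?g' x)"
  define J where "J x w = block (- {\<alpha>}) w +
      axis \<alpha> (linear_solve (partial_jacobian g \<alpha> x) (w $ \<alpha> - ?g' x (block (- {\<alpha>}) w)))" for x w
  have diff: "(g has_derivative ?g' x) (at x)" if "x \<in> U" for x
    using smooth_on_has_derivative[OF assms(2) that] .
  have jac: "partial_jacobian g \<alpha> x *v h = ?g' x (axis \<alpha> h)" if "x \<in> U" for x h
    using diff[OF that] by (intro partial_jacobian_mult differentiableI)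
  have deriv: "(replace_coord \<alpha> g has_derivative ?\<psi>' x) (at x)" if "x \<in> U" for x
    using diff[OF that] by (rule replace_coord_has_derivative)
  have split: "v = block (- {\<alpha>}) v + axis \<alpha> (v $ \<alpha>)" for v :: "('r, 'n) coords"
    by (simp add: vec_eq_iff axis_nth_if)
  have split': "?g' x v = ?g' x (block (- {\<alpha>}) v) + ?g' x (axis \<alpha> (v $ \<alpha>))" if "x \<in> U" for x v
    using linear_add[OF linear_smooth_derivative[OF assms(2) that]] split by metis
  have right: "?\<psi>' x (J x w) = w" if "x \<in> U" for x w
  proof -
    have "block (- {\<alpha>}) (J x w) = block (- {\<alpha>}) w"
      by (simp add: vec_eq_iff J_def axis_nth_if)
    moreover have "?g' x (axis \<alpha> (J x w $ \<alpha>)) = w $ \<alpha> - ?g' x (block (- {\<alpha>}) w)"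
      using jac[OF that, symmetric] mult_linear_solve[OF assms(3)[OF that]]
      by (simp add: J_def axis_nth_if)
    ultimately have "?g' x (J x w) = w $ \<alpha>"
      using split'[OF that, of "J x w"] by simp
    then show ?thesis by (simp add: vec_eq_iff J_def axis_nth_if)
  qed
  have left: "J x (?\<psi>' x v) = v" if "x \<in> U" for x v
  proof -
    have "block (- {\<alpha>}) (?\<psi>' x v) = block (- {\<alpha>}) v" by (simp add: vec_eq_iff)
    moreover have "linear_solve (partial_jacobian g \<alpha> x) (?g' x (axis \<alpha> (v $ \<alpha>))) = v $ \<alpha>"
      using jac[OF that, symmetric] linear_solve_mult[OF assms(3)[OF that]] by simp
    ultimately show ?thesis
      using split split'[OF that, of v] by (simp add: J_def)
  qed
  have bl: "bounded_linear (?\<psi>' x)" if "x \<in> U" for x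
    using deriv[OF that] by (rule has_derivative_bounded_linear)
  define \<Psi> where "\<Psi> x = Blinfun (?\<psi>' x)" for x
  have \<Psi>: "blinfun_apply (\<Psi> x) = ?\<psi>' x" if "x \<in> U" for x
    using bl[OF that] by (simp add: \<Psi>_def bounded_linear_Blinfun_apply)
  have "linear (J x0)"
  proof (rule linearI)
    have lin: "linear (?\<psi>' x0)" using bl[OF assms(4)] by (rule bounded_linear.linear)
    show "J x0 (v + w) = J x0 v + J x0 w" for v w
      using left[OF assms(4), of "J x0 v + J x0 w"] linear_add[OF lin] right[OF assms(4)] by simp
    show "J x0 (c *\<^sub>R v) = c *\<^sub>R J x0 v" for c v
      using left[OF assms(4), of "c *\<^sub>R J x0 v"] linear_cmul[OF lin] right[OF assms(4)] by simp
  qed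
  then have invf: "Blinfun (J x0) o\<^sub>L \<Psi> x0 = id_blinfun"
    using left[OF assms(4)] \<Psi>[OF assms(4)]
    by (intro blinfun_eqI) (simp add: bounded_linear_Blinfun_apply linear_conv_bounded_linear)
  have cont: "continuous_on U \<Psi>"
  proof (rule continuous_on_blinfun_componentwise)
    fix b :: "('r, 'n) coords"
    have "smooth_on U (\<lambda>x. block (- {\<alpha>}) b + axis \<alpha> (?g' x b))"
      using assms(1,2) by (intro smooth_on_add smooth_on_const smooth_on_derivative
          smooth_on_bounded_linear_comp[of _ "axis \<alpha>"]) auto
    from smooth_on_continuous[OF this] show "continuous_on U (\<lambda>x. blinfun_apply (\<Psi> x) b)"
      using \<Psi> by (simp add: replace_coord_def cong: continuous_on_cong)
  qed
  have derf: "(replace_coord \<alpha> g has_derivative blinfun_apply (\<Psi> x)) (at x)" if "x \<in> U" for x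
    using deriv[OF that] \<Psi>[OF that] by simp
  obtain U' V h h' where *: "open U'" "U' \<subseteq> U" "x0 \<in> U'" "open V" "replace_coord \<alpha> g x0 \<in> V"
      "homeomorphism U' V (replace_coord \<alpha> g) h"
      "\<And>y. y \<in> V \<Longrightarrow> (h has_derivative h' y) (at y)"
      "\<And>y. y \<in> V \<Longrightarrow> h' y = inv (blinfun_apply (\<Psi> (h y)))"
    by (rule inverse_function_theorem[OF assms(1) derf cont assms(4) invf]) (assumption, rule that)
  have hV: "h y \<in> U" if "y \<in> V" for y
    using *(2,6) that by (auto simp: homeomorphism_def)
  have "h' y = J (h y)" if "y \<in> V" for y
    unfolding *(8)[OF that] \<Psi>[OF hV[OF that]]
    by (rule inv_equality) (use left right hV[OF that] in auto)
  then have dh: "(h has_derivative J (h y)) (at y)" if "y \<in> V" for y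
    using *(7)[OF that] that by simp
  have "smooth_on U (\<lambda>x. J x w)" for w
    unfolding J_def
    using assms(1-3) smooth_on_partial_jacobian[OF assms(1,2), of \<alpha>]
    by (intro smooth_on_add smooth_on_const smooth_on_bounded_linear_comp[of _ "axis \<alpha>"]
        smooth_on_linear_solve smooth_on_diff) (auto intro: smooth_on_nth smooth_on_derivative)
  then have "smooth_on V h"
    using * dh hV assms(1) by (intro smooth_on_local_inverse[of V U h J]) auto
  moreover have "frechet_derivative h (at y) = J (h y)" if "y \<in> V" for y
    using dh[OF that] frechet_derivative_at by metis
  ultimately show ?thesis
    using * left right hV by (intro that[of U' V h]) auto
qed


section \<open>Reducible functions\<close>

text \<open>
  The first order form, in coordinates, of the statement that the kernel of \<open>dF\<close> on the block \<open>I\<close>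
  does not change along the coordinates in \<open>P\<close>.
\<close>

definition kernel_stationary ::
    "'n set \<Rightarrow> 'n set \<Rightarrow> (('r::finite, 'n::finite) coords \<Rightarrow> real ^ 'r) \<Rightarrow> ('r, 'n) coords \<Rightarrow> bool" where
  "kernel_stationary P I F x \<longleftrightarrow>
     (\<forall>p\<in>P. \<forall>h v. frechet_derivative F (at x) (block I v) = 0 \<longrightarrow>
        frechet_derivative (\<lambda>y. frechet_derivative F (at y) (block I v)) (at x) (axis p h) = 0)"

text \<open>
  Written with the partial Jacobians \<open>F\<^sub>\<beta>\<close>, this is \<open>\<Sum>\<^sub>\<beta>\<^sub>\<in>\<^sub>I F\<^sub>\<alpha>\<^sup>-\<^sup>1 F\<^sub>\<beta> v\<^sub>\<beta>\<close>.  Dividing by \<open>F\<^sub>\<alpha>\<close> keeps the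
  kernel and, for \<open>\<alpha> \<in> I\<close>, normalizes the component \<open>\<alpha>\<close> to the identity, so that the kernel becomes the graph of
  the remaining components; its constancy is then the constancy of this function.
\<close>

definition kernel_coord ::
    "'n set \<Rightarrow> 'n \<Rightarrow> (('r::finite, 'n::finite) coords \<Rightarrow> real ^ 'r) \<Rightarrow> ('r, 'n) coords \<Rightarrow>
     ('r, 'n) coords \<Rightarrow> real ^ 'r" where
  "kernel_coord I \<alpha> F v x = linear_solve (partial_jacobian F \<alpha> x) (frechet_derivative F (at x) (block I v))"

lemma smooth_on_kernel_coord:
  assumes "open C" "smooth_on C F" "\<And>x. x \<in> C \<Longrightarrow> det (partial_jacobian F \<alpha> x) \<noteq> 0"
  shows "smooth_on C (kernel_coord I \<alpha> F v)"
  unfolding kernel_coord_def[abs_def]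
  using assms smooth_on_partial_jacobian[OF assms(1,2), of \<alpha>]
  by (intro smooth_on_linear_solve) (auto intro: smooth_on_nth smooth_on_derivative)

lemma kernel_coord_mult:
  assumes "det (partial_jacobian F \<alpha> x) \<noteq> 0"
  shows "partial_jacobian F \<alpha> x *v kernel_coord I \<alpha> F v x = frechet_derivative F (at x) (block I v)"
  using mult_linear_solve[OF assms] by (simp add: kernel_coord_def)

lemma kernel_coord_eq_0_iff:
  assumes "det (partial_jacobian F \<alpha> x) \<noteq> 0"
  shows "kernel_coord I \<alpha> F v x = 0 \<longleftrightarrow> frechet_derivative F (at x) (block I v) = 0"
  using kernel_coord_mult[OF assms] linear_solve_iff[OF assms, of 0]
  by (metis kernel_coord_def matrix_vector_mult_0_right)

lemma derivative_along_kernel: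
  assumes "open C" "smooth_on C F" "\<And>x. x \<in> C \<Longrightarrow> det (partial_jacobian F \<alpha> x) \<noteq> 0" "x \<in> C"
    and "frechet_derivative F (at x) (block I v) = 0"
  shows "frechet_derivative (\<lambda>y. frechet_derivative F (at y) (block I v)) (at x) u = 0 \<longleftrightarrow>
     frechet_derivative (kernel_coord I \<alpha> F v) (at x) u = 0"
proof -
  let ?w = "kernel_coord I \<alpha> F v" and ?G = "partial_jacobian F \<alpha>"
  have "?G differentiable at x"
    using smooth_on_has_derivative[OF smooth_on_partial_jacobian[OF assms(1,2)] assms(4)]
    by (rule differentiableI)
  then have "((\<lambda>y. ?G y *v ?w y) has_derivative (\<lambda>u. ?G x *v frechet_derivative ?w (at x) u)) (at x)"
    using smooth_on_has_derivative[OF smooth_on_kernel_coord[OF assms(1-3)] assms(4)]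
      kernel_coord_eq_0_iff[OF assms(3)[OF assms(4)]] assms(5)
    by (intro derivative_matrix_mult_at_zero) auto
  then have "((\<lambda>y. frechet_derivative F (at y) (block I v)) has_derivative
      (\<lambda>u. ?G x *v frechet_derivative ?w (at x) u)) (at x)"
    by (rule has_derivative_transform_within_open[OF _ assms(1,4)]) (simp add: kernel_coord_mult assms(3))
  then have "frechet_derivative (\<lambda>y. frechet_derivative F (at y) (block I v)) (at x)
      = (\<lambda>u. ?G x *v frechet_derivative ?w (at x) u)"
    by (rule frechet_derivative_at[symmetric])
  then show ?thesis
    using linear_solve_mult[OF assms(3)[OF assms(4)]] by (metis matrix_vector_mult_0_right)
qed

text \<open>
  The derivative of \<open>kernel_coord I \<alpha> F v\<close> along \<open>P\<close> vanishes for every \<open>v\<close>, not only for kernel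
  vectors: changing the component \<open>\<alpha>\<close> of \<open>v\<close> by a fixed amount changes this function by a constant,
  and at any given point the change can be chosen to put \<open>v\<close> into the kernel.
\<close>

lemma kernel_constant:
  assumes C: "open C" "convex C" and F: "smooth_on C F"
    and det: "\<And>x. x \<in> C \<Longrightarrow> det (partial_jacobian F \<alpha> x) \<noteq> 0"
    and stat: "\<And>x. x \<in> C \<Longrightarrow> kernel_stationary P I F x"
    and "\<alpha> \<in> I" "x \<in> C" "y \<in> C" "block P (y - x) = y - x"
  shows "frechet_derivative F (at x) (block I v) = 0 \<longleftrightarrow> frechet_derivative F (at y) (block I v) = 0"
proof -
  let ?w = "kernel_coord I \<alpha> F"
  have jac: "partial_jacobian F \<alpha> z *v h = frechet_derivative F (at z) (axis \<alpha> h)" if "z \<in> C" for z h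
    using smooth_on_has_derivative[OF F that] by (intro partial_jacobian_mult differentiableI)
  have zero: "frechet_derivative (?w v) (at z) (axis p h) = 0" if z: "z \<in> C" and p: "p \<in> P" for z p h
  proof -
    \<comment> \<open>The component \<open>\<alpha>\<close> is corrected so that \<open>v'\<close> lies in the kernel at \<open>z\<close>.\<close>
    define v' where "v' = v - axis \<alpha> (?w v z)"
    have block: "block I v' = block I v - axis \<alpha> (?w v z)"
      using \<open>\<alpha> \<in> I\<close> by (simp add: v'_def vec_eq_iff axis_nth_if)
    have F_v': "frechet_derivative F (at y) (block I v')
        = frechet_derivative F (at y) (block I v) - partial_jacobian F \<alpha> y *v ?w v z" if "y \<in> C" for y
      using linear_diff[OF linear_smooth_derivative[OF F that]] jac[OF that] by (simp add: block)
    have "frechet_derivative F (at z) (block I v') = 0"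
      using F_v'[OF z] kernel_coord_mult[OF det[OF z]] by simp
    moreover have "frechet_derivative (\<lambda>y. frechet_derivative F (at y) (block I v')) (at z) (axis p h) = 0"
      using stat[OF z] p calculation by (auto simp: kernel_stationary_def)
    ultimately have "frechet_derivative (?w v') (at z) (axis p h) = 0"
      using derivative_along_kernel[OF C(1) F det z] by blast
    moreover have "?w v' y = ?w v y - ?w v z" if "y \<in> C" for y
    proof -
      have "partial_jacobian F \<alpha> y *v (?w v y - ?w v z) = frechet_derivative F (at y) (block I v')"
        using F_v'[OF that] kernel_coord_mult[OF det[OF that]] by (simp add: matrix_vector_mult_diff_distrib)
      then show ?thesis
        using linear_solve_iff[OF det[OF that]] by (simp add: kernel_coord_def)
    qed
    then have "((\<lambda>y. ?w v y - ?w v z) has_derivative frechet_derivative (?w v') (at z)) (at z)"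
      using smooth_on_has_derivative[OF smooth_on_kernel_coord[OF C(1) F det] z, where ?v1 = v']
      by (rule has_derivative_transform_within_open[OF _ C(1) z, rotated]) auto
    then have "(?w v has_derivative frechet_derivative (?w v') (at z)) (at z)"
      using has_derivative_add[OF _ has_derivative_const[of "?w v z"]] by fastforce
    then have "frechet_derivative (?w v) (at z) = frechet_derivative (?w v') (at z)"
      by (rule frechet_derivative_at[symmetric])
    ultimately show ?thesis by simp
  qed
  have "frechet_derivative (?w v) (at z) (y - x) = 0" if "z \<in> C" for z
  proof -
    have lin: "linear (frechet_derivative (?w v) (at z))"
      using linear_smooth_derivative[OF smooth_on_kernel_coord[OF C(1) F det] that] .
    have "frechet_derivative (?w v) (at z) (block P (y - x)) = 0"
      unfolding block_eq_sum_axis linear_sum[OF lin] using zero[OF that] by (intro sum.neutral) auto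
    then show ?thesis using assms(9) by simp
  qed
  then have "?w v x = ?w v y"
    using smooth_on_has_derivative[OF smooth_on_kernel_coord[OF C(1) F det], where ?I1 = I and ?v1 = v]
    by (intro constant_along_segment[OF C(2) assms(7,8), where f' = "\<lambda>z. frechet_derivative (?w v) (at z)"]) auto
  then show ?thesis
    using kernel_coord_eq_0_iff[OF det] assms(7,8) by metis
qed

text \<open>
  Freezing the coordinates in \<open>P\<close> turns \<open>F\<close> into a function \<open>g\<close> of the others whose differential has,
  on the block \<open>I\<close>, the kernel of \<open>dF\<close>.  In the coordinates where \<open>g\<close> takes the place of \<open>x\<^sub>\<alpha>\<close>, the
  kernel consists, among the vectors tangent to \<open>x\<^sub>S = const\<close>, of those with component \<open>0\<close> in the new
  coordinate.
\<close>

lemma straightening: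
  fixes F :: "('r::finite, 'n::finite) coords \<Rightarrow> real ^ 'r"
  assumes part: "P \<union> I \<union> S = UNIV" "P \<inter> I = {}" "P \<inter> S = {}" "I \<inter> S = {}" and "\<alpha> \<in> I"
    and \<Omega>: "open \<Omega>" "x0 \<in> \<Omega>" and F: "smooth_on \<Omega> F"
    and det: "\<And>x. x \<in> \<Omega> \<Longrightarrow> det (partial_jacobian F \<alpha> x) \<noteq> 0"
    and stat: "\<And>x. x \<in> \<Omega> \<Longrightarrow> kernel_stationary P I F x"
  obtains U V h where "open U" "U \<subseteq> \<Omega>" "x0 \<in> U" "\<And>x. x \<in> U \<Longrightarrow> freeze P x0 x \<in> \<Omega>" "open V"
    "homeomorphism U V (replace_coord \<alpha> (F \<circ> freeze P x0)) h"
    "smooth_on U (replace_coord \<alpha> (F \<circ> freeze P x0))" "smooth_on V h"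
    "\<And>y w \<beta>. y \<in> V \<Longrightarrow> \<beta> \<noteq> \<alpha> \<Longrightarrow> frechet_derivative h (at y) w $ \<beta> = w $ \<beta>"
    "\<And>y w. y \<in> V \<Longrightarrow> (\<forall>\<sigma>\<in>S. w $ \<sigma> = 0) \<Longrightarrow>
       frechet_derivative F (at (h y)) (block I (frechet_derivative h (at y) w)) = 0 \<longleftrightarrow> w $ \<alpha> = 0"
proof -
  \<comment> \<open>A box is convex and stable under freezing coordinates at its centre, so \<open>kernel_constant\<close>
    compares each of its points with the frozen one.\<close>
  obtain \<delta> where \<delta>: "0 < \<delta>" "product_domain (\<lambda>\<beta>. ball (x0 $ \<beta>) \<delta>) \<subseteq> \<Omega>"
    using product_domain_of_balls_subset[OF \<Omega>] .
  define C where "C = product_domain (\<lambda>\<beta>. ball (x0 $ \<beta>) \<delta>)"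
  have "x0 \<in> C" using \<delta>(1) by (simp add: C_def product_domain_def)
  then have C: "open C" "convex C" "C \<subseteq> \<Omega>" "x0 \<in> C"
    using \<delta> by (auto simp: C_def intro!: open_product_domain convex_product_domain)
  have freeze_C: "freeze P x0 x \<in> C" if "x \<in> C" for x
    using that C(4) by (auto simp: C_def product_domain_def)
  have FC: "smooth_on C F" using F C(3) smooth_on_subset by blast
  let ?g = "F \<circ> freeze P x0"
  have g: "smooth_on C ?g"
    unfolding o_def using freeze_C by (intro smooth_on_compose[OF C(1,1) _ smooth_on_freeze FC]) (auto simp: C)
  have dg: "frechet_derivative ?g (at x) = (\<lambda>v. frechet_derivative F (at (freeze P x0 x)) (block (- P) v))"
    if "x \<in> C" for x
    unfolding o_def
    by (rule frechet_derivative_at[symmetric], rule has_derivative_compose[OF freeze_has_derivative])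
      (rule smooth_on_has_derivative[OF FC freeze_C[OF that]])
  have "\<alpha> \<notin> P" using part \<open>\<alpha> \<in> I\<close> by auto
  then have "block (- P) (axis \<alpha> h) = axis \<alpha> h" for h :: "real ^ 'r"
    by (auto simp: vec_eq_iff axis_nth_if)
  then have "partial_jacobian ?g \<alpha> x = partial_jacobian F \<alpha> (freeze P x0 x)" if "x \<in> C" for x
    unfolding partial_jacobian_def dg[OF that] by simp
  then have "det (partial_jacobian ?g \<alpha> x) \<noteq> 0" if "x \<in> C" for x
    using that det freeze_C C(3) by auto
  then obtain U V h where UVh: "open U" "U \<subseteq> C" "x0 \<in> U" "open V"
    "homeomorphism U V (replace_coord \<alpha> ?g) h" "smooth_on V h"
    and h': "\<And>y w. y \<in> V \<Longrightarrow> replace_coord \<alpha> (frechet_derivative ?g (at (h y))) (frechet_derivative h (at y) w) = w"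
    using replace_coord_local_diffeomorphism[OF C(1) g _ C(4)] by metis
  show ?thesis
  proof
    show "smooth_on U (replace_coord \<alpha> ?g)"
      using smooth_on_replace_coord[OF UVh(1) smooth_on_subset[OF g UVh(2)]] .
    show *: "frechet_derivative h (at y) w $ \<beta> = w $ \<beta>" if "y \<in> V" "\<beta> \<noteq> \<alpha>" for y w \<beta>
      using h'[OF that(1), of w] that(2) by (metis replace_coord_nth)
    show "frechet_derivative F (at (h y)) (block I (frechet_derivative h (at y) w)) = 0 \<longleftrightarrow> w $ \<alpha> = 0"
      if y: "y \<in> V" and w: "\<forall>\<sigma>\<in>S. w $ \<sigma> = 0" for y w
    proof -
      let ?v = "frechet_derivative h (at y) w"
      have hy: "h y \<in> C" using UVh(2,5) y by (auto simp: homeomorphism_def)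
      have "?v $ \<beta> = 0" if "\<beta> \<in> S" for \<beta>
      proof -
        have "\<beta> \<noteq> \<alpha>" using that part \<open>\<alpha> \<in> I\<close> by auto
        then show ?thesis using *[OF y] w that by simp
      qed
      moreover have "\<beta> \<in> S" if "\<beta> \<notin> P" "\<beta> \<notin> I" for \<beta>
        using part(1) that by blast
      ultimately have "block (- P) ?v $ \<beta> = block I ?v $ \<beta>" for \<beta>
        using part(2) by (cases "\<beta> \<in> P"; cases "\<beta> \<in> I") auto
      then have "block (- P) ?v = block I ?v"
        by (rule vec_eq_iff[THEN iffD2, OF allI])
      then have "w $ \<alpha> = frechet_derivative F (at (freeze P x0 (h y))) (block I ?v)"
        using h'[OF y, of w] dg[OF hy] by (metis replace_coord_nth)
      moreover have "block P (freeze P x0 (h y) - h y) = freeze P x0 (h y) - h y"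
        by (simp add: vec_eq_iff)
      ultimately show ?thesis
        using kernel_constant[OF C(1,2) FC _ _ \<open>\<alpha> \<in> I\<close> hy freeze_C[OF hy], of P] det stat C(3) by auto
    qed
  qed (use UVh C freeze_C in auto)
qed

text \<open>
  In the straightened coordinates the derivative of \<open>F\<close> vanishes along the coordinates in \<open>I\<close> other
  than \<open>\<alpha>\<close>.  Hence \<open>F\<close> keeps its value when these are moved to those of the base point, and \<open>f\<close> may be
  read off there.
\<close>

lemma jointly_reducible_if_kernel_stationary:
  fixes F :: "('r::finite, 'n::{finite, linorder}) coords \<Rightarrow> real ^ 'r"
  assumes "l < k" and "\<alpha> \<in> idx_a l k"
    and \<Omega>: "open \<Omega>" "x0 \<in> \<Omega>" and F: "smooth_on \<Omega> F"
    and det: "\<And>x. x \<in> \<Omega> \<Longrightarrow> det (partial_jacobian F \<alpha> x) \<noteq> 0"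
    and stat: "\<And>x. x \<in> \<Omega> \<Longrightarrow> kernel_stationary (idx_p l) (idx_a l k) F x"
  obtains B where "\<And>\<beta>. open (B \<beta>)" "x0 \<in> product_domain B" "product_domain B \<subseteq> \<Omega>"
    "jointly_reducible_on k l B F"
proof -
  let ?P = "idx_p l :: 'n set" and ?I = "idx_a l k :: 'n set" and ?S = "idx_s k :: 'n set"
  note part = index_groups[OF \<open>l < k\<close>, where 'n = 'n]
  let ?\<psi> = "replace_coord \<alpha> (F \<circ> freeze ?P x0)"
  obtain U V h where U: "open U" "U \<subseteq> \<Omega>" "x0 \<in> U" "\<And>x. x \<in> U \<Longrightarrow> freeze ?P x0 x \<in> \<Omega>"
    and V: "open V" and hom: "homeomorphism U V ?\<psi> h" and smooth: "smooth_on U ?\<psi>" "smooth_on V h"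
    and dh: "\<And>y w \<beta>. y \<in> V \<Longrightarrow> \<beta> \<noteq> \<alpha> \<Longrightarrow> frechet_derivative h (at y) w $ \<beta> = w $ \<beta>"
    and ker: "\<And>y w. y \<in> V \<Longrightarrow> (\<forall>\<sigma>\<in>?S. w $ \<sigma> = 0) \<Longrightarrow>
       frechet_derivative F (at (h y)) (block ?I (frechet_derivative h (at y) w)) = 0 \<longleftrightarrow> w $ \<alpha> = 0"
    using straightening[OF part assms(2) \<Omega> F det stat] by metis
  let ?z = "\<lambda>x. freeze (?I - {\<alpha>}) x0 (?\<psi> x)"
  have "?\<psi> x0 \<in> V" using hom U(3) by (auto simp: homeomorphism_def)
  then obtain e where e: "0 < e" "ball (?\<psi> x0) e \<subseteq> V" using V openE by blast
  let ?E = "ball (?\<psi> x0) e"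
  \<comment> \<open>\<open>?z x\<close> is \<open>?\<psi> x\<close> with the coordinates in \<open>?I\<close> other than \<open>\<alpha>\<close> moved to the base point;
    both must lie in a ball in \<open>V\<close>, so that the segment between them does.\<close>
  have z0: "?z x0 = ?\<psi> x0" by (simp add: vec_eq_iff)
  have "continuous_on U ?\<psi>" using smooth(1) by (rule smooth_on_continuous)
  moreover from this have "continuous_on U ?z"
    by (rule continuous_on_compose2[OF smooth_on_continuous[OF smooth_on_freeze[OF open_UNIV]]]) simp
  ultimately have "open ((U \<inter> ?\<psi> -` ?E) \<inter> (U \<inter> ?z -` ?E))"
    using U(1) by (intro open_Int continuous_open_preimage) auto
  moreover have "x0 \<in> (U \<inter> ?\<psi> -` ?E) \<inter> (U \<inter> ?z -` ?E)"
    using U(3) e(1) z0 by simp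
  ultimately obtain \<delta> where "0 < \<delta>"
    and \<delta>: "product_domain (\<lambda>\<beta>. ball (x0 $ \<beta>) \<delta>) \<subseteq> (U \<inter> ?\<psi> -` ?E) \<inter> (U \<inter> ?z -` ?E)"
    by (rule product_domain_of_balls_subset)
  define B where "B \<beta> = ball (x0 $ \<beta>) \<delta>" for \<beta>
  have "product_domain B \<subseteq> (U \<inter> ?\<psi> -` ?E) \<inter> (U \<inter> ?z -` ?E)"
    using \<delta> by (simp add: B_def[abs_def])
  then have B: "x \<in> U" "?\<psi> x \<in> ?E" "?z x \<in> ?E" if "x \<in> product_domain B" for x
    using that by blast+
  define g where "g u c = F (block ?P x0 + (u + c))" for u c
  define f where "f u y c = F (h (block (?I - {\<alpha>}) x0 + (u + axis \<alpha> y + c)))" for u y c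
  have g_eq: "g (block ?I x) (block ?S x) = F (freeze ?P x0 x)" for x
  proof -
    have "block ?P x0 + (block ?I x + block ?S x) = freeze ?P x0 x"
      using part by (simp add: vec_eq_iff set_eq_iff) blast
    then show ?thesis by (simp add: g_def)
  qed
  have z_eq: "block (?I - {\<alpha>}) x0 + (block ?P x + axis \<alpha> (g (block ?I x) (block ?S x)) + block ?S x) = ?z x" for x
  proof -
    have "\<beta> \<in> ?P \<or> \<beta> \<in> ?S \<or> \<beta> = \<alpha> \<or> \<beta> \<in> ?I - {\<alpha>}" for \<beta>
      using part(1) by blast
    moreover have "\<alpha> \<notin> ?P" "\<alpha> \<notin> ?S"
      using part \<open>\<alpha> \<in> idx_a l k\<close> by auto
    ultimately have "(block (?I - {\<alpha>}) x0 + (block ?P x + axis \<alpha> (F (freeze ?P x0 x)) + block ?S x)) $ \<beta>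
        = ?z x $ \<beta>" for \<beta>
      using part(2-4) \<open>\<alpha> \<in> idx_a l k\<close> by (auto simp: axis_nth_if)
    then show ?thesis
      unfolding g_eq by (rule vec_eq_iff[THEN iffD2, OF allI])
  qed
  have "jointly_reducible_on k l B F"
    unfolding jointly_reducible_on_def
  proof (intro exI conjI ballI)
    have "smooth_near ((\<lambda>x. (block ?I x, block ?S x)) ` product_domain B)
        (\<lambda>w. F (block ?P x0 + (fst w + snd w)))"
    proof (rule smooth_near_compose[OF smooth_near_open[OF \<Omega>(1) F]])
      have "block ?P x0 + (block ?I x + block ?S x) = freeze ?P x0 x" for x
        using part by (simp add: vec_eq_iff set_eq_iff) blast
      then show "(\<lambda>w. block ?P x0 + (fst w + snd w)) ` (\<lambda>x. (block ?I x, block ?S x)) ` product_domain B \<subseteq> \<Omega>"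
        using U(4) B(1) by auto
    qed (intro smooth_on_affine bounded_linear_add bounded_linear_fst bounded_linear_snd)
    then show "smooth_near ((\<lambda>x. (block ?I x, block ?S x)) ` product_domain B) (\<lambda>(u, c). g u c)"
      by (simp add: g_def case_prod_beta')
    have hV: "h ` V \<subseteq> \<Omega>" using hom U(2) by (auto simp: homeomorphism_def)
    have "smooth_near ((\<lambda>x. (block ?P x, g (block ?I x) (block ?S x), block ?S x)) ` product_domain B)
        (\<lambda>w. F (h (block (?I - {\<alpha>}) x0 + (fst w + axis \<alpha> (fst (snd w)) + snd (snd w)))))"
    proof (rule smooth_near_compose[OF smooth_near_open[OF V smooth_on_compose[OF V \<Omega>(1) hV smooth(2) F]]])
      show "(\<lambda>w. block (?I - {\<alpha>}) x0 + (fst w + axis \<alpha> (fst (snd w)) + snd (snd w))) `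
          (\<lambda>x. (block ?P x, g (block ?I x) (block ?S x), block ?S x)) ` product_domain B \<subseteq> V"
        using z_eq B(3) e(2) by auto
    qed (intro smooth_on_affine bounded_linear_add bounded_linear_fst bounded_linear_snd
        bounded_linear_compose[OF bounded_linear_axis] bounded_linear_fst_comp bounded_linear_snd_comp)
    then show "smooth_near ((\<lambda>x. (block ?P x, g (block ?I x) (block ?S x), block ?S x)) ` product_domain B)
        (\<lambda>(u, y, c). f u y c)"
      by (simp add: f_def case_prod_beta')
    fix x assume x: "x \<in> product_domain B"
    have "F (h (?\<psi> x)) = F (h (?z x))"
    proof (rule constant_along_segment[where C = ?E and f = "\<lambda>y. F (h y)" and x = "?\<psi> x" and y = "?z x"
          and f' = "\<lambda>y w. frechet_derivative F (at (h y)) (frechet_derivative h (at y) w)"])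
      fix y assume "y \<in> ?E"
      then have y: "y \<in> V" using e(2) by blast
      let ?h' = "frechet_derivative h (at y)"
      show "((\<lambda>y. F (h y)) has_derivative (\<lambda>w. frechet_derivative F (at (h y)) (?h' w))) (at y)"
        using hV y by (auto intro!: has_derivative_compose[OF smooth_on_has_derivative[OF smooth(2) y]
              smooth_on_has_derivative[OF F]])
      let ?w = "?z x - ?\<psi> x"
      have w: "?w $ \<beta> = 0" if "\<beta> \<notin> ?I - {\<alpha>}" for \<beta>
        using that by auto
      have "block ?I (?h' ?w) = ?h' ?w"
      proof (rule vec_eq_iff[THEN iffD2, OF allI])
        fix \<beta>
        show "block ?I (?h' ?w) $ \<beta> = ?h' ?w $ \<beta>"
          using dh[OF y, of \<beta> ?w] w[of \<beta>] \<open>\<alpha> \<in> idx_a l k\<close> by (cases "\<beta> \<in> ?I") auto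
      qed
      moreover have "\<forall>\<sigma>\<in>?S. ?w $ \<sigma> = 0" using w part(4) by blast
      ultimately show "frechet_derivative F (at (h y)) (?h' ?w) = 0"
        using ker[OF y] w[of \<alpha>] by (metis DiffD2 singletonI)
    qed (use B[OF x] in auto)
    moreover have "h (?\<psi> x) = x" using hom B(1)[OF x] by (auto simp: homeomorphism_def)
    ultimately show "F x = f (block ?P x) (g (block ?I x) (block ?S x)) (block ?S x)"
      by (simp add: f_def z_eq)
  qed
  moreover have "x0 \<in> product_domain B" using \<open>0 < \<delta>\<close> by (simp add: B_def product_domain_def)
  moreover have "product_domain B \<subseteq> \<Omega>" using B(1) U(2) by blast
  ultimately show ?thesis using that[of B] by (simp add: B_def)
qed

text \<open>
  The representing functions are the same.  On a product domain every value of the block \<open>I\<close> occurs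
  together with every value \<open>c\<close> of the block \<open>S\<close>, so fixing \<open>c\<close> stays within the domain where the joint
  functions are smooth.
\<close>

lemma fibrewise_reducible_if_jointly_reducible:
  fixes F :: "('r::finite, 'n::{finite, linorder}) coords \<Rightarrow> real ^ 'r"
  assumes "l < k" and "jointly_reducible_on k l B F"
  shows "fibrewise_reducible_on k l B F"
proof -
  let ?P = "idx_p l :: 'n set" and ?I = "idx_a l k :: 'n set" and ?S = "idx_s k :: 'n set"
  note part = index_groups[OF \<open>l < k\<close>, where 'n = 'n]
  obtain f :: "('r, 'n) coords \<Rightarrow> real ^ 'r \<Rightarrow> ('r, 'n) coords \<Rightarrow> real ^ 'r"
    and g :: "('r, 'n) coords \<Rightarrow> ('r, 'n) coords \<Rightarrow> real ^ 'r" where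
    g: "smooth_near ((\<lambda>x. (block ?I x, block ?S x)) ` product_domain B) (\<lambda>(u, c). g u c)" and
    f: "smooth_near ((\<lambda>x. (block ?P x, g (block ?I x) (block ?S x), block ?S x)) ` product_domain B)
         (\<lambda>(u, y, c). f u y c)" and
    F: "\<And>x. x \<in> product_domain B \<Longrightarrow>
      F x = f (block ?P x) (g (block ?I x) (block ?S x)) (block ?S x)"
    using assms(2) unfolding jointly_reducible_on_def by blast
  show ?thesis
    unfolding fibrewise_reducible_on_def
  proof (intro exI ballI conjI impI)
    fix c assume "c \<in> block ?S ` product_domain B"
    then obtain x' where x': "x' \<in> product_domain B" "c = block ?S x'" by blast
    have mix: "block ?P (freeze ?S x' x) = block ?P x" "block ?I (freeze ?S x' x) = block ?I x"
      "block ?S (freeze ?S x' x) = c" for x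
      using part x'(2) by (auto simp: block_def fun_eq_iff intro!: Cart_lambda_cong)
    have "smooth_near (block ?I ` product_domain B) (\<lambda>u. (\<lambda>(u, c). g u c) ((0, c) + (u, 0)))"
    proof (rule smooth_near_compose[OF g])
      show "(\<lambda>u. (0, c) + (u, 0)) ` block ?I ` product_domain B
          \<subseteq> (\<lambda>x. (block ?I x, block ?S x)) ` product_domain B"
        using mix freeze_in_product_domain[OF _ x'(1), of _ ?S] by (auto simp: image_iff) metis
    qed (intro smooth_on_affine bounded_linear_Pair bounded_linear_ident bounded_linear_zero)
    then show "smooth_near (block ?I ` product_domain B) (\<lambda>u. g u c)" by simp
    have "smooth_near ((\<lambda>x. (block ?P x, g (block ?I x) c)) ` product_domain B)
        (\<lambda>w. (\<lambda>(u, y, c). f u y c) ((0, 0, c) + (fst w, snd w, 0)))"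
    proof (rule smooth_near_compose[OF f])
      show "(\<lambda>w. (0, 0, c) + (fst w, snd w, 0)) ` (\<lambda>x. (block ?P x, g (block ?I x) c)) ` product_domain B
          \<subseteq> (\<lambda>x. (block ?P x, g (block ?I x) (block ?S x), block ?S x)) ` product_domain B"
        using mix freeze_in_product_domain[OF _ x'(1), of _ ?S] by (auto simp: image_iff) metis
    qed (intro smooth_on_affine bounded_linear_Pair bounded_linear_fst bounded_linear_snd bounded_linear_zero)
    then show "smooth_near ((\<lambda>x. (block ?P x, g (block ?I x) c)) ` product_domain B) (\<lambda>(u, y). f u y c)"
      by (simp add: case_prod_beta')
  qed (use F in auto)
qed

text \<open>
  By the chain rule \<open>dF = (\<partial>f/\<partial>g) \<circ> dg\<close> on the block \<open>I\<close>.  Since already the part in \<open>x\<^sub>\<alpha>\<close> is onto, the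
  endomorphism \<open>\<partial>f/\<partial>g\<close> of \<open>\<real>\<^sup>r\<close> is onto and hence injective, and a kernel vector of \<open>dF\<close> is one of \<open>dg\<close>.
  As \<open>dg\<close> does not see \<open>x\<^sub>P\<close>, that vector remains in the kernel along \<open>P\<close>.
\<close>

lemma kernel_stationary_if_fibrewise_reducible:
  fixes F :: "('r::finite, 'n::{finite, linorder}) coords \<Rightarrow> real ^ 'r"
  assumes "l < k" and "\<alpha> \<in> idx_a l k"
    and B: "\<And>\<beta>. open (B \<beta>)" and F: "smooth_on (product_domain B) F"
    and det: "\<And>x. x \<in> product_domain B \<Longrightarrow> det (partial_jacobian F \<alpha> x) \<noteq> 0"
    and "fibrewise_reducible_on k l B F" and x: "x \<in> product_domain B"
  shows "kernel_stationary (idx_p l) (idx_a l k) F x"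
proof -
  let ?P = "idx_p l :: 'n set" and ?I = "idx_a l k :: 'n set" and ?S = "idx_s k :: 'n set"
  note part = index_groups[OF \<open>l < k\<close>, where 'n = 'n]
  let ?c = "block ?S x"
  obtain f :: "('r, 'n) coords \<Rightarrow> real ^ 'r \<Rightarrow> ('r, 'n) coords \<Rightarrow> real ^ 'r"
    and g :: "('r, 'n) coords \<Rightarrow> ('r, 'n) coords \<Rightarrow> real ^ 'r"
    where fg: "\<forall>c\<in>block ?S ` product_domain B.
      smooth_near (block ?I ` product_domain B) (\<lambda>u. g u c) \<and>
      smooth_near ((\<lambda>x. (block ?P x, g (block ?I x) c)) ` product_domain B) (\<lambda>(u, y). f u y c) \<and>
      (\<forall>x\<in>product_domain B. block ?S x = c \<longrightarrow> F x = f (block ?P x) (g (block ?I x) c) c)"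
    using assms(6) unfolding fibrewise_reducible_on_def by blast
  have "?c \<in> block ?S ` product_domain B" using x by (rule imageI)
  note fg_c = bspec[OF fg this]
  have F_eq: "F z = f (block ?P z) (g (block ?I z) ?c) ?c"
    if "z \<in> product_domain B" "block ?S z = ?c" for z
    using fg_c that by blast
  from fg_c obtain Tg Tf where
    Tg: "block ?I ` product_domain B \<subseteq> Tg" "smooth_on Tg (\<lambda>u. g u ?c)" and
    Tf: "(\<lambda>x. (block ?P x, g (block ?I x) ?c)) ` product_domain B \<subseteq> Tf" "smooth_on Tf (\<lambda>(u, y). f u y ?c)"
    unfolding smooth_near_def by blast
  let ?f' = "\<lambda>z. frechet_derivative (\<lambda>(u, y). f u y ?c) (at (block ?P z, g (block ?I z) ?c))"
  let ?g' = "\<lambda>z. frechet_derivative (\<lambda>u. g u ?c) (at (block ?I z))"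
  have f': "((\<lambda>(u, y). f u y ?c) has_derivative ?f' z) (at (block ?P z, g (block ?I z) ?c))"
    and g': "((\<lambda>u. g u ?c) has_derivative ?g' z) (at (block ?I z))"
    if "z \<in> product_domain B" for z
    using Tg(1) Tf(1) that by (auto intro!: smooth_on_has_derivative[OF Tg(2)] smooth_on_has_derivative[OF Tf(2)])
  have F': "frechet_derivative F (at z) (block ?I v) = ?f' z (0, ?g' z (block ?I v))"
    if z: "z \<in> product_domain B" and zS: "block ?S z = ?c" for z v
  proof -
    have "((\<lambda>v. F (z + block ?I v)) has_derivative (\<lambda>v. frechet_derivative F (at z) (block ?I v))) (at 0)"
      by (rule has_derivative_compose[of "\<lambda>v. z + block ?I v" "block ?I"])
        (use smooth_on_has_derivative[OF F z] in \<open>auto intro!: derivative_eq_intros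
          bounded_linear_imp_has_derivative simp: linear_0 bounded_linear.linear\<close>)
    moreover have "((\<lambda>v. (\<lambda>(u, y). f u y ?c) (block ?P z, g (block ?I z + block ?I v) ?c)) has_derivative
        (\<lambda>v. ?f' z (0, ?g' z (block ?I v)))) (at 0)"
    proof (rule has_derivative_compose[of "\<lambda>v. (block ?P z, g (block ?I z + block ?I v) ?c)"])
      have "((\<lambda>v. g (block ?I z + block ?I v) ?c) has_derivative (\<lambda>v. ?g' z (block ?I v))) (at 0)"
        by (rule has_derivative_compose[of "\<lambda>v. block ?I z + block ?I v" "block ?I"])
          (use g'[OF z] in \<open>auto intro!: derivative_eq_intros
            bounded_linear_imp_has_derivative simp: linear_0 bounded_linear.linear\<close>)
      then show "((\<lambda>v. (block ?P z, g (block ?I z + block ?I v) ?c)) has_derivative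
          (\<lambda>v. (0, ?g' z (block ?I v)))) (at 0)"
        by (intro has_derivative_Pair has_derivative_const)
    qed (use f'[OF z] in \<open>simp add: linear_0 bounded_linear.linear\<close>)
    then have "((\<lambda>v. F (z + block ?I v)) has_derivative (\<lambda>v. ?f' z (0, ?g' z (block ?I v)))) (at 0)"
    proof (rule has_derivative_transform_within_open)
      show "open ((\<lambda>v. z + block ?I v) -` product_domain B)"
        by (intro open_vimage open_product_domain B continuous_intros linear_continuous_on bounded_linear_block)
      fix v assume v: "v \<in> (\<lambda>v. z + block ?I v) -` product_domain B"
      have "block ?P (z + block ?I v) = block ?P z" "block ?S (z + block ?I v) = ?c"
        "block ?I (z + block ?I v) = block ?I z + block ?I v"
        using part zS by (simp_all add: block_add block_block block_empty Int_commute)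
      then show "(case (block ?P z, g (block ?I z + block ?I v) ?c) of (u, y) \<Rightarrow> f u y ?c) = F (z + block ?I v)"
        using F_eq v by simp
    qed (use z in \<open>simp add: linear_0 bounded_linear.linear\<close>)
    ultimately show ?thesis
      using has_derivative_unique by (metis (no_types, lifting))
  qed
  have kernel: "?g' x (block ?I v) = 0" if "frechet_derivative F (at x) (block ?I v) = 0" for v
  proof -
    let ?L = "\<lambda>w. ?f' x (0, w)"
    have lin: "linear ?L"
      using linear_compose[OF bounded_linear.linear[OF bounded_linear_Pair[OF bounded_linear_zero bounded_linear_ident]]
          has_derivative_linear[OF f'[OF x]]] by (simp add: o_def)
    moreover have "surj ?L"
    proof (rule surjI)
      fix w
      let ?h = "linear_solve (partial_jacobian F \<alpha> x) w"
      have "block ?I (axis \<alpha> ?h) = axis \<alpha> ?h"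
        using \<open>\<alpha> \<in> idx_a l k\<close> by (simp add: vec_eq_iff axis_nth_if)
      then show "?L (?g' x (axis \<alpha> ?h)) = w"
        using F'[OF x refl, of "axis \<alpha> ?h"] mult_linear_solve[OF det[OF x]]
          partial_jacobian_mult[OF differentiableI[OF smooth_on_has_derivative[OF F x]]] by metis
    qed
    ultimately have "inj ?L" by (rule linear_surj_imp_inj)
    moreover have "?L (?g' x (block ?I v)) = ?L 0"
      using F'[OF x refl] that linear_0[OF lin] by simp
    ultimately show ?thesis by (rule injD)
  qed
  show ?thesis
    unfolding kernel_stationary_def
  proof (intro ballI allI impI)
    fix p h v assume p: "p \<in> ?P" and v: "frechet_derivative F (at x) (block ?I v) = 0"
    show "frechet_derivative (\<lambda>y. frechet_derivative F (at y) (block ?I v)) (at x) (axis p h) = 0"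
    proof (rule derivative_zero_along_line[OF _ open_product_domain[OF B] x])
      show "((\<lambda>y. frechet_derivative F (at y) (block ?I v)) has_derivative
          frechet_derivative (\<lambda>y. frechet_derivative F (at y) (block ?I v)) (at x)) (at x)"
        using smooth_on_has_derivative[OF smooth_on_derivative[OF F] x] .
      fix t assume t: "x + t *\<^sub>R axis p h \<in> product_domain B"
      have "block ?I (x + t *\<^sub>R axis p h) = block ?I x" "block ?S (x + t *\<^sub>R axis p h) = ?c"
        using part p by (auto simp: block_add block_scaleR block_axis)
      then show "frechet_derivative F (at (x + t *\<^sub>R axis p h)) (block ?I v) = 0"
        using F'[OF t] kernel[OF v] linear_0[OF has_derivative_linear[OF f'[OF t]]] by (simp add: zero_prod_def)
    qed
  qed
qed


section \<open>Charts and leaves\<close>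

lemma chart_homeomorphism:
  "is_chart c \<Longrightarrow> homeomorphism (fst c) (snd c ` fst c) (snd c) (chart_inv c)"
  by (simp add: is_chart_def)

lemma chart_inv_chart [simp]: "is_chart c \<Longrightarrow> x \<in> fst c \<Longrightarrow> chart_inv c (snd c x) = x"
  by (rule homeomorphism_apply1[OF chart_homeomorphism])

lemma chart_chart_inv [simp]: "is_chart c \<Longrightarrow> y \<in> snd c ` fst c \<Longrightarrow> snd c (chart_inv c y) = y"
  by (rule homeomorphism_apply2[OF chart_homeomorphism])

lemma chart_open_image:
  assumes "is_chart c" "open N" shows "open (snd c ` (fst c \<inter> N))"
proof -
  have "openin (top_of_set (fst c)) (fst c \<inter> N)"
    using assms(2) by blast
  then have "openin (top_of_set (snd c ` fst c)) (snd c ` (fst c \<inter> N))"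
    by (rule homeomorphism_imp_open_map[OF chart_homeomorphism[OF assms(1)]])
  then show ?thesis
    using assms(1) openin_open_trans by (auto simp: is_chart_def)
qed

lemma differential_factors:
  assumes c: "is_chart c" "x \<in> fst c" and "locally_factors W f g" "x \<in> W"
    and "(g \<circ> chart_inv c) differentiable at (snd c x)"
  obtains \<gamma>' where "linear \<gamma>'" "\<And>v. differential c f x v = \<gamma>' (differential c g x v)"
proof -
  obtain N \<gamma> where N: "open N" "x \<in> N" "smooth_near (g ` N) \<gamma>" "\<And>y. y \<in> N \<Longrightarrow> f y = \<gamma> (g y)"
    using assms(3,4) unfolding locally_factors_def by meson
  then obtain T where T: "g ` N \<subseteq> T" "smooth_on T \<gamma>" unfolding smooth_near_def by blast
  let ?\<gamma>' = "frechet_derivative \<gamma> (at (g x))"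
  have \<gamma>: "(\<gamma> has_derivative ?\<gamma>') (at (g x))"
    using smooth_on_has_derivative[OF T(2)] T(1) N(2) by blast
  have "((\<lambda>y. \<gamma> ((g \<circ> chart_inv c) y)) has_derivative (\<lambda>v. ?\<gamma>' (differential c g x v))) (at (snd c x))"
  proof (rule has_derivative_compose[where f = "g \<circ> chart_inv c" and g = \<gamma>
        and f' = "differential c g x" and g' = ?\<gamma>'])
    show "((g \<circ> chart_inv c) has_derivative differential c g x) (at (snd c x))"
      using assms(5) unfolding differential_def by (simp add: frechet_derivative_works)
    show "(\<gamma> has_derivative ?\<gamma>') (at ((g \<circ> chart_inv c) (snd c x)))"
      using \<gamma> c by simp
  qed
  then have "((f \<circ> chart_inv c) has_derivative (\<lambda>v. ?\<gamma>' (differential c g x v))) (at (snd c x))"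
  proof (rule has_derivative_transform_within_open)
    show "open (snd c ` (fst c \<inter> N))" using c(1) N(1) by (rule chart_open_image)
    show "snd c x \<in> snd c ` (fst c \<inter> N)" using c(2) N(2) by simp
    show "\<gamma> ((g \<circ> chart_inv c) y) = (f \<circ> chart_inv c) y" if "y \<in> snd c ` (fst c \<inter> N)" for y
      using that N(4) c(1) by auto
  qed
  then have "differential c f x = (\<lambda>v. ?\<gamma>' (differential c g x v))"
    unfolding differential_def by (rule frechet_derivative_at[symmetric])
  then show ?thesis using that[of ?\<gamma>'] has_derivative_linear[OF \<gamma>] by simp
qed

lemma submersion_on_differentiable:
  assumes "submersion_on A U g" "c \<in> A" "x \<in> fst c \<inter> U"
  shows "(g \<circ> chart_inv c) differentiable at (snd c x)"
proof -
  have "smooth_on (snd c ` (fst c \<inter> U)) (g \<circ> chart_inv c)"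
    using assms(1,2) unfolding submersion_on_def smooth_map_on_def by blast
  then show ?thesis
    using smooth_on_has_derivative assms(3) by (blast intro: differentiableI)
qed

text \<open>
  \<open>f\<close> and any submersion of the cocycle are locally functions of each other, so their differentials
  have the same kernel.
\<close>

lemma leaf_tangent_eq_kernel:
  assumes A: "c \<in> A" "is_chart c" and fol: "foliation A L" and leaves: "leaves_given_by A L D f"
    and x: "x \<in> fst c \<inter> D"
  shows "leaf_tangent L c x = {v. differential c f x v = 0}"
proof -
  have f: "(f \<circ> chart_inv c) differentiable at (snd c x)"
    using leaves x A(1) by (auto simp: leaves_given_by_def intro: submersion_on_differentiable)
  have g: "(g \<circ> chart_inv c) differentiable at (snd c x)" if "(U, g) \<in> L" "x \<in> U" for U g
    using fol that x A(1) by (auto simp: foliation_def intro!: submersion_on_differentiable[of A U])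
  have fg: "locally_factors (D \<inter> U) f g" "locally_factors (D \<inter> U) g f" if "(U, g) \<in> L" for U g
    using leaves that unfolding leaves_given_by_def by auto
  have iff: "differential c f x v = 0 \<longleftrightarrow> differential c g x v = 0" if L: "(U, g) \<in> L" "x \<in> U" for U g v
  proof -
    have xD: "x \<in> D \<inter> U" using x L by simp
    obtain \<gamma> where "linear \<gamma>" "\<And>v. differential c f x v = \<gamma> (differential c g x v)"
      using differential_factors[OF A(2) _ fg(1)[OF L(1)] xD g[OF L]] x by blast
    moreover obtain \<gamma>' where "linear \<gamma>'" "\<And>v. differential c g x v = \<gamma>' (differential c f x v)"
      using differential_factors[OF A(2) _ fg(2)[OF L(1)] xD f] x by blast
    ultimately show ?thesis by (metis linear_0)
  qed
  have "x \<in> (\<Union>(U, f)\<in>L. U)" using fol by (simp add: foliation_def)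
  then obtain U g where "(U, g) \<in> L" "x \<in> U" by auto
  then show ?thesis
    unfolding leaf_tangent_def using iff by fastforce
qed


section \<open>The coframe and the torsion tensor\<close>

text \<open>
  A vector annihilated by \<open>\<omega>\<^sub>1, \<dots>, \<omega>\<^sub>n\<close> is tangent to the leaves of the first \<open>n\<close> foliations, hence
  orthogonal to their conormal spaces, which span; so the forms are jointly injective, and onto by dimension.
\<close>

lemma coframe_surjective:
  fixes W :: "'n::finite option \<Rightarrow> ('m::topological_space, 'r::finite) foliation"
  assumes "web A W" "adapted_coframe A W D \<omega>" "c \<in> A" "x \<in> fst c \<inter> D"
  obtains v where "\<And>\<alpha>. \<omega> (Some \<alpha>) c x v = t \<alpha>"
proof -
  let ?\<Omega> = "\<lambda>v. \<chi> \<alpha>. \<omega> (Some \<alpha>) c x v"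
  have lin_\<omega>: "linear (\<omega> \<xi> c x)" for \<xi>
    using assms(2-4) by (auto simp: adapted_coframe_def one_form_on_def)
  have lin: "linear ?\<Omega>"
    by (rule linearI) (simp_all add: vec_eq_iff linear_add[OF lin_\<omega>] linear_cmul[OF lin_\<omega>])
  have "v = 0" if "?\<Omega> v = 0" for v
  proof -
    have v: "v \<in> leaf_tangent (W \<xi>) c x" if "\<xi> \<noteq> None" for \<xi>
    proof -
      obtain \<alpha> where "\<xi> = Some \<alpha>" using \<open>\<xi> \<noteq> None\<close> by blast
      moreover have "\<omega> (Some \<alpha>) c x v = 0"
        using \<open>?\<Omega> v = 0\<close> by (metis vec_lambda_beta zero_index)
      ultimately show ?thesis using assms(2-4) unfolding adapted_coframe_def by blast
    qed
    have "span (\<Union>\<xi>\<in>- {None}. conormal (W \<xi>) c x) = UNIV"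
      using assms(1,3,4) by (auto simp: web_def)
    then have "v \<in> span (\<Union>\<xi>\<in>- {None}. conormal (W \<xi>) c x)" by simp
    then have "orthogonal v v"
    proof (rule orthogonal_to_span)
      fix w assume "w \<in> (\<Union>\<xi>\<in>- {None}. conormal (W \<xi>) c x)"
      then show "orthogonal v w"
        using v unfolding conormal_def orthogonal_comp_def by blast
    qed
    then show ?thesis by (simp add: orthogonal_def)
  qed
  then have "inj ?\<Omega>" using linear_injective_0[OF lin] by blast
  then have "surj ?\<Omega>" using lin linear_inj_imp_surj by blast
  then obtain v where "?\<Omega> v = (\<chi> \<alpha>. t \<alpha>)" by (metis surjD)
  then show ?thesis using that by (metis vec_lambda_beta)
qed

text \<open>
  In the structure equations only the terms pairing \<open>\<omega>\<^sub>\<alpha>(v)\<close> with \<open>\<omega>\<^sub>p(u)\<close> survive: \<open>u\<close> has no components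
  in \<open>I\<close>, and the terms with the connection form add up to a multiple of \<open>\<Sum>\<^sub>\<alpha>\<^sub>\<in>\<^sub>I \<omega>\<^sub>\<alpha>(v) = 0\<close>.
\<close>

lemma ext_deriv_along_block:
  fixes \<omega> :: "'n::finite option \<Rightarrow> ('m, 'r::finite, 'n, real ^ 'r) form"
  assumes tor: "torsion_tensor A D \<omega> a" and x: "c \<in> A" "x \<in> fst c \<inter> D" and "p \<notin> I"
    and u: "\<And>\<beta>. \<beta> \<noteq> p \<Longrightarrow> \<omega> (Some \<beta>) c x u = 0"
    and v: "\<And>\<beta>. \<beta> \<notin> I \<Longrightarrow> \<omega> (Some \<beta>) c x v = 0" "(\<Sum>\<alpha>\<in>I. \<omega> (Some \<alpha>) c x v) = 0"
  shows "(\<Sum>\<alpha>\<in>I. ext_deriv (form_comp (\<omega> (Some \<alpha>)) i) c x u v) =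
    - (\<Sum>j\<in>UNIV. \<Sum>m\<in>UNIV. \<Sum>\<alpha>\<in>I. a \<alpha> p i j m x * (\<omega> (Some \<alpha>) c x v $ j) * (\<omega> (Some p) c x u $ m))"
proof -
  let ?\<omega> = "\<lambda>\<alpha>. \<omega> (Some \<alpha>) c x"
  obtain \<kappa> :: "'r \<Rightarrow> 'r \<Rightarrow> ('m, 'r, 'n, real) form" where
    str: "\<And>\<alpha> i u v. ext_deriv (form_comp (\<omega> (Some \<alpha>)) i) c x u v =
             (\<Sum>j\<in>UNIV. wedge (form_comp (\<omega> (Some \<alpha>)) j) (\<kappa> i j) c x u v) +
             (\<Sum>\<beta>\<in>- {\<alpha>}. \<Sum>j\<in>UNIV. \<Sum>m\<in>UNIV. a \<alpha> \<beta> i j m x *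
                wedge (form_comp (\<omega> (Some \<alpha>)) j) (form_comp (\<omega> (Some \<beta>)) m) c x u v)"
    using tor x unfolding torsion_tensor_def by meson
  have "ext_deriv (form_comp (\<omega> (Some \<alpha>)) i) c x u v =
      (\<Sum>j\<in>UNIV. - ((?\<omega> \<alpha> v $ j) * \<kappa> i j c x u)) +
      (\<Sum>j\<in>UNIV. \<Sum>m\<in>UNIV. - (a \<alpha> p i j m x * (?\<omega> \<alpha> v $ j) * (?\<omega> p u $ m)))" if \<alpha>: "\<alpha> \<in> I" for \<alpha>
  proof -
    have "\<alpha> \<noteq> p" using \<alpha> \<open>p \<notin> I\<close> by blast
    have wedge: "wedge (form_comp (\<omega> (Some \<alpha>)) j) \<eta> c x u v = - ((?\<omega> \<alpha> v $ j) * \<eta> c x u)"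
      for j and \<eta> :: "('m, 'r, 'n, real) form"
      using u[OF \<open>\<alpha> \<noteq> p\<close>] by (simp add: wedge_def form_comp_def)
    have "(\<Sum>\<beta>\<in>- {\<alpha>}. \<Sum>j\<in>UNIV. \<Sum>m\<in>UNIV. a \<alpha> \<beta> i j m x *
                wedge (form_comp (\<omega> (Some \<alpha>)) j) (form_comp (\<omega> (Some \<beta>)) m) c x u v)
      = (\<Sum>\<beta>\<in>- {\<alpha>}. if p = \<beta> then \<Sum>j\<in>UNIV. \<Sum>m\<in>UNIV. - (a \<alpha> p i j m x * (?\<omega> \<alpha> v $ j) * (?\<omega> p u $ m)) else 0)"
      unfolding wedge using u by (intro sum.cong) (auto simp: form_comp_def mult.assoc)
    also have "\<dots> = (\<Sum>j\<in>UNIV. \<Sum>m\<in>UNIV. - (a \<alpha> p i j m x * (?\<omega> \<alpha> v $ j) * (?\<omega> p u $ m)))"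
      using \<open>\<alpha> \<noteq> p\<close> by (subst sum.delta') auto
    finally show ?thesis unfolding str by (simp add: wedge)
  qed
  then have "(\<Sum>\<alpha>\<in>I. ext_deriv (form_comp (\<omega> (Some \<alpha>)) i) c x u v) =
      - (\<Sum>\<alpha>\<in>I. \<Sum>j\<in>UNIV. (?\<omega> \<alpha> v $ j) * \<kappa> i j c x u) +
      - (\<Sum>\<alpha>\<in>I. \<Sum>j\<in>UNIV. \<Sum>m\<in>UNIV. a \<alpha> p i j m x * (?\<omega> \<alpha> v $ j) * (?\<omega> p u $ m))"
    by (simp add: sum_subtractf sum_negf)
  also have "(\<Sum>\<alpha>\<in>I. \<Sum>j\<in>UNIV. (?\<omega> \<alpha> v $ j) * \<kappa> i j c x u) = (\<Sum>j\<in>UNIV. (\<Sum>\<alpha>\<in>I. ?\<omega> \<alpha> v) $ j * \<kappa> i j c x u)"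
    by (subst sum.swap) (simp add: sum_component sum_distrib_right)
  also have "\<dots> = 0" using v(2) by simp
  also have "(\<Sum>\<alpha>\<in>I. \<Sum>j\<in>UNIV. \<Sum>m\<in>UNIV. a \<alpha> p i j m x * (?\<omega> \<alpha> v $ j) * (?\<omega> p u $ m))
     = (\<Sum>j\<in>UNIV. \<Sum>m\<in>UNIV. \<Sum>\<alpha>\<in>I. a \<alpha> p i j m x * (?\<omega> \<alpha> v $ j) * (?\<omega> p u $ m))"
    by (subst sum.swap, rule sum.cong, rule refl, rule sum.swap)
  finally show ?thesis by simp
qed

definition torsion_condition ::
    "'n set \<Rightarrow> 'n set \<Rightarrow> ('n \<Rightarrow> 'n \<Rightarrow> 'r \<Rightarrow> 'r \<Rightarrow> 'r \<Rightarrow> 'm \<Rightarrow> real) \<Rightarrow> 'm \<Rightarrow> bool" where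
  "torsion_condition P I a x \<longleftrightarrow>
     (\<forall>p\<in>P. \<forall>\<alpha>\<in>I. \<forall>\<beta>\<in>I. \<forall>i j m. a p \<alpha> i j m x = a p \<beta> i j m x)"

text \<open>
  If \<open>a\<^sub>\<alpha>\<^sub>p\<close> is the same for all \<open>\<alpha> \<in> I\<close>, it can be taken out of the sum over \<open>\<alpha>\<close>, which leaves
  \<open>\<Sum>\<^sub>\<alpha>\<^sub>\<in>\<^sub>I \<omega>\<^sub>\<alpha>(v) = 0\<close>.  Conversely the vectors \<open>u\<close>, \<open>v\<close> can be chosen with prescribed components, and
  the components \<open>e\<^sub>m\<close> and \<open>- e\<^sub>m\<close> of \<open>v\<close> in two directions isolate a difference of two coefficients.
\<close>

lemma torsion_condition_iff_ext_deriv: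
  fixes W :: "'n::finite option \<Rightarrow> ('m::topological_space, 'r::finite) foliation"
  assumes "web A W" and cof: "adapted_coframe A W D \<omega>" and tor: "torsion_tensor A D \<omega> a"
    and x: "c \<in> A" "x \<in> fst c \<inter> D" and "P \<inter> I = {}"
  shows "torsion_condition P I a x \<longleftrightarrow>
    (\<forall>p\<in>P. \<forall>u v. (\<forall>\<beta>. \<beta> \<noteq> p \<longrightarrow> \<omega> (Some \<beta>) c x u = 0) \<longrightarrow> (\<forall>\<beta>. \<beta> \<notin> I \<longrightarrow> \<omega> (Some \<beta>) c x v = 0) \<longrightarrow>
       (\<Sum>\<alpha>\<in>I. \<omega> (Some \<alpha>) c x v) = 0 \<longrightarrow>
       (\<forall>i. (\<Sum>\<alpha>\<in>I. ext_deriv (form_comp (\<omega> (Some \<alpha>)) i) c x u v) = 0))" (is "?L \<longleftrightarrow> ?R")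
proof -
  let ?\<omega> = "\<lambda>\<alpha>. \<omega> (Some \<alpha>) c x"
  have sym: "a \<alpha> \<beta> i j m x = a \<beta> \<alpha> i m j x" if "\<alpha> \<noteq> \<beta>" for \<alpha> \<beta> i j m
    using tor x(2) that unfolding torsion_tensor_def by (metis IntD2)
  show ?thesis
  proof
    assume L: ?L
    show ?R
    proof (intro ballI allI impI)
      fix p u v i
      assume p: "p \<in> P" and u: "\<forall>\<beta>. \<beta> \<noteq> p \<longrightarrow> ?\<omega> \<beta> u = 0" and v: "\<forall>\<beta>. \<beta> \<notin> I \<longrightarrow> ?\<omega> \<beta> v = 0"
        and v0: "(\<Sum>\<alpha>\<in>I. ?\<omega> \<alpha> v) = 0"
      have "p \<notin> I" using p assms(6) by blast
      have "(\<Sum>\<alpha>\<in>I. a \<alpha> p i j m x * (?\<omega> \<alpha> v $ j) * (?\<omega> p u $ m)) = 0" for j m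
      proof (cases "I = {}")
        case False
        then obtain \<beta> where \<beta>: "\<beta> \<in> I" by blast
        have "a \<alpha> p i j m x = a p \<beta> i m j x" if "\<alpha> \<in> I" for \<alpha>
        proof -
          have "\<alpha> \<noteq> p" using that \<open>p \<notin> I\<close> by blast
          then show ?thesis using L p that \<beta> sym unfolding torsion_condition_def by metis
        qed
        then have "(\<Sum>\<alpha>\<in>I. a \<alpha> p i j m x * (?\<omega> \<alpha> v $ j) * (?\<omega> p u $ m))
            = a p \<beta> i m j x * (\<Sum>\<alpha>\<in>I. ?\<omega> \<alpha> v) $ j * (?\<omega> p u $ m)"
          by (simp add: sum_component sum_distrib_left sum_distrib_right)
        then show ?thesis using v0 by simp
      qed simp
      then show "(\<Sum>\<alpha>\<in>I. ext_deriv (form_comp (\<omega> (Some \<alpha>)) i) c x u v) = 0"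
        using ext_deriv_along_block[OF tor x \<open>p \<notin> I\<close>, of u v i] u v v0 by simp
    qed
  next
    assume R: ?R
    show ?L
      unfolding torsion_condition_def
    proof (intro ballI allI)
      fix p \<alpha> \<beta> i j m
      assume p: "p \<in> P" and \<alpha>: "\<alpha> \<in> I" and \<beta>: "\<beta> \<in> I"
      have "p \<notin> I" using p assms(6) by blast
      show "a p \<alpha> i j m x = a p \<beta> i j m x"
      proof (cases "\<alpha> = \<beta>")
        case False
        obtain u where u: "\<And>\<gamma>. ?\<omega> \<gamma> u = (if \<gamma> = p then axis j 1 else 0)"
          using coframe_surjective[OF assms(1,2) x, of "\<lambda>\<gamma>. if \<gamma> = p then axis j 1 else 0"] by blast
        obtain v where v: "\<And>\<gamma>. ?\<omega> \<gamma> v = (if \<gamma> = \<alpha> then axis m 1 else if \<gamma> = \<beta> then - axis m 1 else 0)"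
          using coframe_surjective[OF assms(1,2) x,
              of "\<lambda>\<gamma>. if \<gamma> = \<alpha> then axis m 1 else if \<gamma> = \<beta> then - axis m 1 else 0"] by blast
        have split: "(\<Sum>\<gamma>\<in>I. f \<gamma>) = f \<alpha> + f \<beta>" if "\<And>\<gamma>. \<gamma> \<noteq> \<alpha> \<Longrightarrow> \<gamma> \<noteq> \<beta> \<Longrightarrow> f \<gamma> = 0"
          for f :: "'n \<Rightarrow> 'z::comm_monoid_add"
        proof -
          have "(\<Sum>\<gamma>\<in>I. f \<gamma>) = (\<Sum>\<gamma>\<in>{\<alpha>, \<beta>}. f \<gamma>)"
            using that \<alpha> \<beta> by (intro sum.mono_neutral_right) auto
          then show ?thesis using False by simp
        qed
        have "(\<Sum>\<gamma>\<in>I. ?\<omega> \<gamma> v) = 0"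
          using False by (subst split) (auto simp: v)
        moreover have "?\<omega> \<gamma> v = 0" if "\<gamma> \<notin> I" for \<gamma>
          using that \<alpha> \<beta> v by auto
        ultimately have "(\<Sum>j'\<in>UNIV. \<Sum>m'\<in>UNIV. \<Sum>\<gamma>\<in>I. a \<gamma> p i j' m' x * (?\<omega> \<gamma> v $ j') * (?\<omega> p u $ m')) = 0"
          using R p ext_deriv_along_block[OF tor x \<open>p \<notin> I\<close>, of u v i] u by simp
        also have "(\<Sum>j'\<in>UNIV. \<Sum>m'\<in>UNIV. \<Sum>\<gamma>\<in>I. a \<gamma> p i j' m' x * (?\<omega> \<gamma> v $ j') * (?\<omega> p u $ m'))
          = (\<Sum>j'\<in>UNIV. \<Sum>m'\<in>UNIV. if m' = j then (if j' = m then a \<alpha> p i m j x - a \<beta> p i m j x else 0) else 0)"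
          using False by (intro sum.cong refl, subst split) (auto simp: u v axis_nth_if)
        finally have "a \<alpha> p i m j x = a \<beta> p i m j x" by simp
        moreover have "\<alpha> \<noteq> p" "\<beta> \<noteq> p" using \<alpha> \<beta> \<open>p \<notin> I\<close> by auto
        ultimately show ?thesis using sym by metis
      qed simp
    qed
  qed
qed

lemma adapted_form_smooth:
  assumes "adapted_coframe A W D \<omega>" "c \<in> A"
  shows "smooth_on (snd c ` (fst c \<inter> D)) (\<lambda>y. \<omega> \<xi> c (chart_inv c y) v)"
  using assms by (auto simp: adapted_coframe_def one_form_on_def)

lemma sum_ext_deriv:
  assumes cof: "adapted_coframe A W D \<omega>" and c: "c \<in> A" "is_chart c" and x: "x \<in> fst c \<inter> D"
  shows "(\<Sum>\<alpha>\<in>I. ext_deriv (form_comp (\<omega> (Some \<alpha>)) i) c x u v) =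
    (frechet_derivative (\<lambda>y. \<Sum>\<alpha>\<in>I. \<omega> (Some \<alpha>) c (chart_inv c y) v) (at (snd c x)) u -
     frechet_derivative (\<lambda>y. \<Sum>\<alpha>\<in>I. \<omega> (Some \<alpha>) c (chart_inv c y) u) (at (snd c x)) v) $ i"
proof -
  let ?d = "\<lambda>\<alpha> v. frechet_derivative (\<lambda>y. \<omega> (Some \<alpha>) c (chart_inv c y) v) (at (snd c x))"
  have d: "((\<lambda>y. \<omega> (Some \<alpha>) c (chart_inv c y) v) has_derivative ?d \<alpha> v) (at (snd c x))" for \<alpha> v
    using smooth_on_has_derivative[OF adapted_form_smooth[OF cof c(1)]] x by blast
  have "((\<lambda>y. \<omega> (Some \<alpha>) c (chart_inv c y) v $ i) has_derivative (\<lambda>u. ?d \<alpha> v u $ i)) (at (snd c x))" for \<alpha> v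
    using bounded_linear.has_derivative[OF bounded_linear_vec_nth d] .
  then have comp: "frechet_derivative (\<lambda>y. \<omega> (Some \<alpha>) c (chart_inv c y) v $ i) (at (snd c x)) = (\<lambda>u. ?d \<alpha> v u $ i)" for \<alpha> v
    by (rule frechet_derivative_at[symmetric])
  have "((\<lambda>y. \<Sum>\<alpha>\<in>I. \<omega> (Some \<alpha>) c (chart_inv c y) v) has_derivative (\<lambda>u. \<Sum>\<alpha>\<in>I. ?d \<alpha> v u)) (at (snd c x))" for v
    using d by (rule has_derivative_sum)
  then have "frechet_derivative (\<lambda>y. \<Sum>\<alpha>\<in>I. \<omega> (Some \<alpha>) c (chart_inv c y) v) (at (snd c x)) = (\<lambda>u. \<Sum>\<alpha>\<in>I. ?d \<alpha> v u)" for v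
    by (rule frechet_derivative_at[symmetric])
  then show ?thesis
    by (simp add: ext_deriv_def form_comp_def comp sum_subtractf sum_component)
qed

lemma smooth_structure_chart: "smooth_structure A \<Longrightarrow> c \<in> A \<Longrightarrow> is_chart c"
  by (simp add: smooth_structure_def)


section \<open>The coframe in the coordinates of a closed form equation\<close>

lemma differential_in_chart:
  assumes c: "is_chart c" "x \<in> fst c" and f: "(f has_derivative f') (at (snd c x))"
    and eq: "\<And>z. z \<in> fst c \<Longrightarrow> g z = f (snd c z)"
  shows "differential c g x = f'"
  unfolding differential_def
proof (rule frechet_derivative_at[symmetric])
  show "((g \<circ> chart_inv c) has_derivative f') (at (snd c x))"
    by (rule has_derivative_transform_within_open[OF f, of "snd c ` fst c"])
      (use c eq in \<open>auto simp: is_chart_def[THEN iffD1]\<close>)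
qed

context
  fixes A :: "('m::{t2_space, second_countable_topology}, 'r::finite, 'n::finite) chart set"
    and W :: "'n option \<Rightarrow> ('m, 'r) foliation" and c :: "('m, 'r, 'n) chart"
    and F :: "('r, 'n) coords \<Rightarrow> real ^ 'r" and D :: "'m set"
    and \<omega> :: "'n option \<Rightarrow> ('m, 'r, 'n, real ^ 'r) form"
  assumes A: "smooth_structure A" and web: "web A W"
    and closed: "closed_form A W (fst c) (snd c) F" and cof: "adapted_coframe A W D \<omega>"
begin

lemma closed_form_facts:
  "c \<in> A" "is_chart c" "smooth_on (snd c ` fst c) F" "open (snd c ` fst c)"
  "y \<in> snd c ` fst c \<Longrightarrow> det (partial_jacobian F \<alpha> y) \<noteq> 0"
proof -
  show "c \<in> A" using closed by (simp add: closed_form_def)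
  then show "is_chart c" using A smooth_structure_chart by blast
  then show "open (snd c ` fst c)" by (simp add: is_chart_def)
  show "smooth_on (snd c ` fst c) F" "y \<in> snd c ` fst c \<Longrightarrow> det (partial_jacobian F \<alpha> y) \<noteq> 0"
    using closed by (auto simp: closed_form_def)
qed

lemma coframe_kernels:
  assumes x: "x \<in> fst c \<inter> D"
  shows "\<omega> (Some \<alpha>) c x v = 0 \<longleftrightarrow> v $ \<alpha> = 0"
    and "\<omega> None c x v = 0 \<longleftrightarrow> frechet_derivative F (at (snd c x)) v = 0"
proof -
  note c = closed_form_facts(1,2)
  have fol: "foliation A (W \<xi>)" for \<xi> using web by (simp add: web_def)
  have ker: "{v. \<omega> \<xi> c x v = 0} = leaf_tangent (W \<xi>) c x" for \<xi>
    using cof c(1) x unfolding adapted_coframe_def by blast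
  have leaves: "leaves_given_by A (W (Some \<alpha>)) (fst c) (\<lambda>x. snd c x $ \<alpha>)"
    "leaves_given_by A (W None) (fst c) (F \<circ> snd c)"
    using closed unfolding closed_form_def by blast+
  have "differential c (\<lambda>x. snd c x $ \<alpha>) x = (\<lambda>v. v $ \<alpha>)"
    by (rule differential_in_chart[where f = "\<lambda>y. y $ \<alpha>"])
      (use c x in \<open>auto intro: bounded_linear_imp_has_derivative bounded_linear_vec_nth\<close>)
  then show "\<omega> (Some \<alpha>) c x v = 0 \<longleftrightarrow> v $ \<alpha> = 0"
    using ker[of "Some \<alpha>"] leaf_tangent_eq_kernel[OF c fol leaves(1), of x] x by auto
  have "differential c (F \<circ> snd c) x = frechet_derivative F (at (snd c x))"
    by (rule differential_in_chart[where f = F])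
      (use c x in \<open>auto intro: smooth_on_has_derivative[OF closed_form_facts(3)]\<close>)
  then show "\<omega> None c x v = 0 \<longleftrightarrow> frechet_derivative F (at (snd c x)) v = 0"
    using ker[of None] leaf_tangent_eq_kernel[OF c fol leaves(2), of x] x by auto
qed

lemma coframe_linear: "x \<in> fst c \<inter> D \<Longrightarrow> linear (\<omega> \<xi> c x)"
  using cof closed_form_facts(1) by (auto simp: adapted_coframe_def one_form_on_def)

text \<open>
  The normalization makes the forms \<open>\<omega>\<^sub>\<beta> = M F\<^sub>\<beta> dx\<^sub>\<beta>\<close> with one invertible matrix \<open>M\<close>, so the sum over \<open>I\<close>
  is \<open>M\<close> applied to \<open>dF\<close> on the block \<open>I\<close>, and \<open>M F\<^sub>\<alpha>\<close> is \<open>\<omega>\<^sub>\<alpha>\<close> on the coordinate vectors of index \<open>\<alpha>\<close>.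
  In the proof \<open>M\<close> is never formed: the block of \<open>v\<close>, corrected in the component \<open>\<alpha>\<close> so as to lie in
  the kernel of \<open>dF\<close>, is annihilated by \<open>\<omega>\<^sub>n\<^sub>+\<^sub>1\<close> and therefore by the sum of the other forms.
\<close>

lemma coframe_block_sum:
  assumes x: "x \<in> fst c \<inter> D" and "\<alpha> \<in> I"
  shows "(\<Sum>\<beta>\<in>I. \<omega> (Some \<beta>) c x v) = \<omega> (Some \<alpha>) c x (axis \<alpha> (kernel_coord I \<alpha> F v (snd c x)))"
proof -
  let ?y = "snd c x"
  let ?w = "axis \<alpha> (kernel_coord I \<alpha> F v ?y)"
  have y: "?y \<in> snd c ` fst c" using x by blast
  note lin = coframe_linear[OF x]
  have F: "(F has_derivative frechet_derivative F (at ?y)) (at ?y)"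
    using smooth_on_has_derivative[OF closed_form_facts(3) y] .
  have "frechet_derivative F (at ?y) (block I v - ?w) = 0"
    using kernel_coord_mult[OF closed_form_facts(5)[OF y], of \<alpha> I v] partial_jacobian_mult[OF differentiableI[OF F]]
      linear_diff[OF has_derivative_linear[OF F]] by simp
  then have "\<omega> None c x (block I v - ?w) = 0"
    using coframe_kernels(2)[OF x] by blast
  then have "(\<Sum>\<beta>\<in>UNIV. \<omega> (Some \<beta>) c x (block I v - ?w)) = 0"
    using cof closed_form_facts(1) x unfolding adapted_coframe_def by (metis add.right_neutral)
  then have "(\<Sum>\<beta>\<in>UNIV. \<omega> (Some \<beta>) c x (block I v)) = (\<Sum>\<beta>\<in>UNIV. \<omega> (Some \<beta>) c x ?w)"
    by (simp add: linear_diff[OF lin] sum_subtractf)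
  also have "(\<Sum>\<beta>\<in>UNIV. \<omega> (Some \<beta>) c x ?w) = (\<Sum>\<beta>\<in>{\<alpha>}. \<omega> (Some \<beta>) c x ?w)"
    by (rule sum.mono_neutral_right) (auto simp: coframe_kernels(1)[OF x] axis_nth_if)
  also have "(\<Sum>\<beta>\<in>UNIV. \<omega> (Some \<beta>) c x (block I v)) = (\<Sum>\<beta>\<in>I. \<omega> (Some \<beta>) c x (block I v))"
    by (rule sum.mono_neutral_right) (auto simp: coframe_kernels(1)[OF x])
  also have "(\<Sum>\<beta>\<in>I. \<omega> (Some \<beta>) c x (block I v)) = (\<Sum>\<beta>\<in>I. \<omega> (Some \<beta>) c x v)"
  proof (rule sum.cong[OF refl])
    fix \<beta> assume "\<beta> \<in> I"
    then have "\<omega> (Some \<beta>) c x (block I v - v) = 0" using coframe_kernels(1)[OF x] by simp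
    then show "\<omega> (Some \<beta>) c x (block I v) = \<omega> (Some \<beta>) c x v" by (simp add: linear_diff[OF lin])
  qed
  finally show ?thesis by simp
qed

lemma coframe_block_sum_eq_0_iff:
  assumes x: "x \<in> fst c \<inter> D" and "I \<noteq> {}"
  shows "(\<Sum>\<beta>\<in>I. \<omega> (Some \<beta>) c x v) = 0 \<longleftrightarrow> frechet_derivative F (at (snd c x)) (block I v) = 0"
proof -
  obtain \<alpha> where "\<alpha> \<in> I" using \<open>I \<noteq> {}\<close> by blast
  have y: "snd c x \<in> snd c ` fst c" using x by blast
  show ?thesis
    unfolding coframe_block_sum[OF x \<open>\<alpha> \<in> I\<close>] coframe_kernels(1)[OF x] axis_nth
    by (rule kernel_coord_eq_0_iff[OF closed_form_facts(5)[OF y]])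
qed

text \<open>
  The sum of the forms and \<open>dF\<close> on the block are both an invertible matrix times the same function
  \<open>kernel_coord\<close>, which vanishes at the point considered; so each derivative vanishes together with
  that of \<open>kernel_coord\<close>.
\<close>

lemma derivative_of_block_sum_eq_0_iff:
  assumes x: "x \<in> fst c \<inter> D" and "I \<noteq> {}" and v: "(\<Sum>\<beta>\<in>I. \<omega> (Some \<beta>) c x v) = 0"
  shows "frechet_derivative (\<lambda>y. \<Sum>\<beta>\<in>I. \<omega> (Some \<beta>) c (chart_inv c y) v) (at (snd c x)) u = 0 \<longleftrightarrow>
    frechet_derivative (\<lambda>y. frechet_derivative F (at y) (block I v)) (at (snd c x)) u = 0"
proof -
  obtain \<alpha> where \<alpha>: "\<alpha> \<in> I" using \<open>I \<noteq> {}\<close> by blast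
  let ?y = "snd c x" and ?Y = "snd c ` (fst c \<inter> D)"
  let ?w = "kernel_coord I \<alpha> F v"
  define M where "M y = matrix (\<lambda>h. \<omega> (Some \<alpha>) c (chart_inv c y) (axis \<alpha> h))" for y
  have y: "?y \<in> snd c ` fst c" "?y \<in> ?Y" using x by blast+
  have Y: "chart_inv c z \<in> fst c \<inter> D" "snd c (chart_inv c z) = z" if "z \<in> ?Y" for z
    using that closed_form_facts(2) by auto
  have "open D" using cof by (simp add: adapted_coframe_def)
  then have openY: "open ?Y" using closed_form_facts(2) chart_open_image by blast
  have M: "M z *v h = \<omega> (Some \<alpha>) c (chart_inv c z) (axis \<alpha> h)" if "z \<in> ?Y" for z h
  proof -
    have "linear (\<lambda>h. \<omega> (Some \<alpha>) c (chart_inv c z) (axis \<alpha> h))"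
      using linear_compose[OF bounded_linear.linear[OF bounded_linear_axis] coframe_linear[OF Y(1)[OF that]]]
      by (simp add: o_def)
    then show ?thesis unfolding M_def using matrix_vector_mul by metis
  qed
  have "smooth_on ?Y M"
    unfolding M_def[abs_def] matrix_def
    using adapted_form_smooth[OF cof closed_form_facts(1)] openY
    by (intro smooth_on_vec_lambda) (auto intro: smooth_on_nth)
  then have "M differentiable at ?y"
    using smooth_on_has_derivative y(2) differentiableI by blast
  moreover have "(?w has_derivative frechet_derivative ?w (at ?y)) (at ?y)"
    by (rule smooth_on_has_derivative[OF smooth_on_kernel_coord[OF closed_form_facts(4,3,5)] y(1)])
  moreover have Fv: "frechet_derivative F (at ?y) (block I v) = 0"
    using v coframe_block_sum_eq_0_iff[OF x \<open>I \<noteq> {}\<close>] by blast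
  then have "?w ?y = 0"
    using kernel_coord_eq_0_iff[OF closed_form_facts(5)[OF y(1)]] by blast
  ultimately have "((\<lambda>y. M y *v ?w y) has_derivative (\<lambda>u. M ?y *v frechet_derivative ?w (at ?y) u)) (at ?y)"
    by (rule derivative_matrix_mult_at_zero)
  then have "((\<lambda>y. \<Sum>\<beta>\<in>I. \<omega> (Some \<beta>) c (chart_inv c y) v) has_derivative
      (\<lambda>u. M ?y *v frechet_derivative ?w (at ?y) u)) (at ?y)"
    by (rule has_derivative_transform_within_open[OF _ openY y(2)])
      (simp add: M coframe_block_sum[OF Y(1) \<alpha>] Y(2))
  then have "frechet_derivative (\<lambda>y. \<Sum>\<beta>\<in>I. \<omega> (Some \<beta>) c (chart_inv c y) v) (at ?y)
      = (\<lambda>u. M ?y *v frechet_derivative ?w (at ?y) u)"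
    by (rule frechet_derivative_at[symmetric])
  moreover have "M ?y *v h = 0 \<longleftrightarrow> h = 0" for h
    using M[OF y(2)] coframe_kernels(1)[OF Y(1)[OF y(2)], of \<alpha> "axis \<alpha> h"] by (simp add: axis_nth_if)
  ultimately show ?thesis
    using derivative_along_kernel[OF closed_form_facts(4,3,5) y(1) Fv] by simp
qed

text \<open>
  For a coordinate vector \<open>u\<close> of an index in \<open>P\<close> the sum \<open>\<Sum>\<^sub>\<beta>\<^sub>\<in>\<^sub>I \<omega>\<^sub>\<beta>(u)\<close> vanishes identically, so its exterior
  derivative on \<open>u\<close>, \<open>v\<close> is the single term in which \<open>u\<close> differentiates.
\<close>

lemma kernel_stationary_iff_torsion_condition:
  assumes tor: "torsion_tensor A D \<omega> a" and x: "x \<in> fst c \<inter> D" and PI: "P \<inter> I = {}" "I \<noteq> {}"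
  shows "kernel_stationary P I F (snd c x) \<longleftrightarrow> torsion_condition P I a x"
proof -
  let ?\<Theta> = "\<lambda>v y. \<Sum>\<beta>\<in>I. \<omega> (Some \<beta>) c (chart_inv c y) v"
  let ?y = "snd c x" and ?Y = "snd c ` (fst c \<inter> D)"
  have Y: "chart_inv c z \<in> fst c \<inter> D" if "z \<in> ?Y" for z
    using that closed_form_facts(2) by auto
  have "open D" using cof by (simp add: adapted_coframe_def)
  then have openY: "open ?Y" using closed_form_facts(2) chart_open_image by blast
  have yY: "?y \<in> ?Y" using x by blast
  have \<Theta>_u: "frechet_derivative (?\<Theta> u) (at ?y) v = 0" if "\<And>\<beta>. \<beta> \<in> I \<Longrightarrow> u $ \<beta> = 0" for u v
  proof -
    have "((\<lambda>_. 0) has_derivative (\<lambda>_. 0)) (at ?y)" by (rule has_derivative_const)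
    then have "(?\<Theta> u has_derivative (\<lambda>_. 0)) (at ?y)"
    proof (rule has_derivative_transform_within_open[OF _ openY yY])
      fix z assume "z \<in> ?Y"
      then show "0 = ?\<Theta> u z"
        using coframe_kernels(1)[OF Y] that by (intro sum.neutral[symmetric]) blast
    qed
    then have "frechet_derivative (?\<Theta> u) (at ?y) = (\<lambda>_. 0)"
      by (rule frechet_derivative_at[symmetric])
    then show ?thesis by simp
  qed
  have d: "(\<forall>i. (\<Sum>\<alpha>\<in>I. ext_deriv (form_comp (\<omega> (Some \<alpha>)) i) c x u v) = 0) \<longleftrightarrow>
      frechet_derivative (\<lambda>y. frechet_derivative F (at y) (block I v)) (at ?y) u = 0"
    if "\<And>\<beta>. \<beta> \<in> I \<Longrightarrow> u $ \<beta> = 0" "(\<Sum>\<beta>\<in>I. \<omega> (Some \<beta>) c x v) = 0" for u v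
  proof -
    have "frechet_derivative (?\<Theta> u) (at ?y) v = 0" using that(1) by (rule \<Theta>_u)
    then show ?thesis
      unfolding sum_ext_deriv[OF cof closed_form_facts(1,2) x]
        derivative_of_block_sum_eq_0_iff[OF x PI(2) that(2), symmetric]
      by (simp add: vec_eq_iff)
  qed
  have only_p: "(\<forall>\<beta>. \<beta> \<noteq> p \<longrightarrow> u $ \<beta> = 0) \<longleftrightarrow> (\<exists>h. u = axis p h)" for p and u :: "('r, 'n) coords"
  proof
    assume "\<forall>\<beta>. \<beta> \<noteq> p \<longrightarrow> u $ \<beta> = 0"
    then have "u $ \<beta> = axis p (u $ p) $ \<beta>" for \<beta> by (simp add: axis_nth_if)
    then show "\<exists>h. u = axis p h" by (metis vec_eq_iff)
  qed (auto simp: axis_nth_if)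
  have only_I: "(\<forall>\<beta>. \<beta> \<notin> I \<longrightarrow> v $ \<beta> = 0) \<longleftrightarrow> v = block I v" for v :: "('r, 'n) coords"
    unfolding vec_eq_iff[of v "block I v"] block_nth by auto
  have "torsion_condition P I a x \<longleftrightarrow>
    (\<forall>p\<in>P. \<forall>u v. (\<exists>h. u = axis p h) \<longrightarrow> v = block I v \<longrightarrow>
       frechet_derivative F (at ?y) (block I v) = 0 \<longrightarrow>
       (\<forall>i. (\<Sum>\<alpha>\<in>I. ext_deriv (form_comp (\<omega> (Some \<alpha>)) i) c x u v) = 0))"
    unfolding torsion_condition_iff_ext_deriv[OF web cof tor closed_form_facts(1) x PI(1)]
      coframe_kernels(1)[OF x] coframe_block_sum_eq_0_iff[OF x PI(2)] only_p only_I ..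
  also have "\<dots> \<longleftrightarrow> (\<forall>p\<in>P. \<forall>h v. frechet_derivative F (at ?y) (block I v) = 0 \<longrightarrow>
       frechet_derivative (\<lambda>y. frechet_derivative F (at y) (block I v)) (at ?y) (axis p h) = 0)"
    (is "?L \<longleftrightarrow> ?R")
  proof -
    have d': "(\<forall>i. (\<Sum>\<alpha>\<in>I. ext_deriv (form_comp (\<omega> (Some \<alpha>)) i) c x (axis p h) v) = 0) \<longleftrightarrow>
      frechet_derivative (\<lambda>y. frechet_derivative F (at y) (block I v)) (at ?y) (axis p h) = 0"
      if "p \<in> P" "frechet_derivative F (at ?y) (block I v) = 0" for p h v
      using that PI by (intro d) (auto simp: axis_nth_if coframe_block_sum_eq_0_iff[OF x PI(2)])
    have bb: "block I (block I v) = block I v" for v :: "('r, 'n) coords"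
      by (simp add: block_block)
    show ?thesis
    proof
      assume L: ?L
      show ?R
      proof (intro ballI allI impI)
        fix p h v assume p: "p \<in> P" and v: "frechet_derivative F (at ?y) (block I v) = 0"
        have "\<forall>i. (\<Sum>\<alpha>\<in>I. ext_deriv (form_comp (\<omega> (Some \<alpha>)) i) c x (axis p h) (block I v)) = 0"
          using L p v bb by metis
        then show "frechet_derivative (\<lambda>y. frechet_derivative F (at y) (block I v)) (at ?y) (axis p h) = 0"
          using d'[OF p, of "block I v" h] v by (simp add: bb)
      qed
    next
      assume ?R
      then show ?L using d' by blast
    qed
  qed
  finally show ?thesis by (simp add: kernel_stationary_def)
qed

end


section \<open>Integral manifolds\<close>

text \<open>
  The transition maps of the new chart are those of \<open>c\<close> composed with \<open>\<psi>\<close> and \<open>h\<close>, hence smooth, and the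
  atlas is maximal.
\<close>

lemma changed_chart:
  assumes A: "smooth_structure A" and c: "c \<in> A"
    and UV: "open U" "U \<subseteq> snd c ` fst c" "open V" "homeomorphism U V \<psi> h" "smooth_on U \<psi>" "smooth_on V h"
  defines "d \<equiv> (chart_inv c ` U, \<psi> \<circ> snd c)"
  shows "d \<in> A" "snd d ` fst d = V" "\<And>y. y \<in> V \<Longrightarrow> chart_inv d y = chart_inv c (h y)"
proof -
  have chart_c: "is_chart c" using smooth_structure_chart[OF A c] .
  have U: "snd c (chart_inv c y) = y" "chart_inv c y \<in> fst c" if "y \<in> U" for y
    using that UV(2) chart_c by auto
  have \<psi>h: "\<psi> (h y) = y" "h y \<in> U" if "y \<in> V" for y
    using UV(4) that by (auto simp: homeomorphism_def)
  have h\<psi>: "h (\<psi> y) = y" "\<psi> y \<in> V" if "y \<in> U" for y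
    using UV(4) that by (auto simp: homeomorphism_def)
  have fst_d: "fst d = chart_inv c ` U" "snd d x = \<psi> (snd c x)" for x by (simp_all add: d_def)
  have fst_d': "fst d = fst c \<inter> snd c -` U"
  proof (intro equalityI subsetI)
    show "x \<in> fst c \<inter> snd c -` U" if "x \<in> fst d" for x using that U unfolding fst_d by auto
    show "x \<in> fst d" if "x \<in> fst c \<inter> snd c -` U" for x
      unfolding fst_d using that chart_c by (intro image_eqI[of x "chart_inv c" "snd c x"]) simp_all
  qed
  show img: "snd d ` fst d = V"
  proof -
    have "snd d ` fst d = \<psi> ` U" unfolding fst_d image_image using U(1) by simp
    also have "\<dots> = V" using UV(4) by (simp add: homeomorphism_def)
    finally show ?thesis .
  qed
  have inj: "inj_on (snd d) (fst d)"
  proof (rule inj_on_inverseI)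
    fix x assume "x \<in> fst d"
    then have "x \<in> fst c" "snd c x \<in> U" by (auto simp: fst_d')
    then show "chart_inv c (h (snd d x)) = x"
      using h\<psi>(1) chart_c by (simp add: fst_d(2))
  qed
  show inv_d: "chart_inv d y = chart_inv c (h y)" if "y \<in> V" for y
    by (rule inv_into_f_eq[OF inj]) (use that \<psi>h U in \<open>auto simp: fst_d\<close>)
  have cont_c: "continuous_on (fst c) (snd c)" "continuous_on (snd c ` fst c) (chart_inv c)" "open (fst c)"
    using chart_homeomorphism[OF chart_c, THEN homeomorphism_cont1]
      chart_homeomorphism[OF chart_c, THEN homeomorphism_cont2] chart_c unfolding is_chart_def by blast+
  have cont: "continuous_on U \<psi>" "continuous_on V h"
    using UV(4)[THEN homeomorphism_cont1] UV(4)[THEN homeomorphism_cont2] by blast+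
  have chart_d: "is_chart d"
    unfolding is_chart_def img
  proof (intro conjI)
    show "open (fst d)" unfolding fst_d' using cont_c UV(1) by (intro continuous_open_preimage)
    show "homeomorphism (fst d) V (snd d) (chart_inv d)"
      unfolding homeomorphism_def
    proof (intro conjI ballI)
      show "chart_inv d (snd d x) = x" if "x \<in> fst d" for x using inj that by simp
      show "snd d (chart_inv d y) = y" if "y \<in> V" for y using img that by (simp add: f_inv_into_f)
      show "chart_inv d ` V = fst d" using inj img by (metis inv_into_image_cancel subset_refl)
      have "continuous_on (fst d) (\<lambda>x. \<psi> (snd c x))"
        by (rule continuous_on_compose2[OF cont(1) continuous_on_subset[OF cont_c(1)]]) (auto simp: fst_d')
      then show "continuous_on (fst d) (snd d)" by (simp add: d_def o_def)
      have "continuous_on V (\<lambda>y. chart_inv c (h y))"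
        by (rule continuous_on_compose2[OF cont_c(2) cont(2)]) (use \<psi>h UV(2) in blast)
      then show "continuous_on V (chart_inv d)" using inv_d by (simp cong: continuous_on_cong)
    qed (fact img)
  qed (fact UV(3))
  have "smoothly_compatible d e" if e: "e \<in> A" for e
  proof -
    have chart_e: "is_chart e" using smooth_structure_chart[OF A e] .
    have ce: "smooth_on (snd c ` (fst c \<inter> fst e)) (snd e \<circ> chart_inv c)"
      "smooth_on (snd e ` (fst c \<inter> fst e)) (snd c \<circ> chart_inv e)"
      using A c e unfolding smooth_structure_def smoothly_compatible_def by blast+
    have open_e: "open (fst e)" and open_d: "open (fst d)"
      using chart_e chart_d by (auto simp: is_chart_def)
    have open1: "open (snd d ` (fst d \<inter> fst e))" "open (snd c ` (fst c \<inter> fst e))"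
      using chart_d chart_c open_e by (auto intro: chart_open_image)
    have open2: "open (snd e ` (fst d \<inter> fst e))"
      using chart_open_image[OF chart_e open_d] by (simp add: Int_commute)
    have "smooth_on (snd d ` (fst d \<inter> fst e)) (\<lambda>y. (snd e \<circ> chart_inv c) (h y))"
    proof (rule smooth_on_compose[OF open1 _ _ ce(1)])
      show "smooth_on (snd d ` (fst d \<inter> fst e)) h"
        by (rule smooth_on_subset[OF UV(6)]) (use img in auto)
      show "h ` snd d ` (fst d \<inter> fst e) \<subseteq> snd c ` (fst c \<inter> fst e)"
        by (auto simp: fst_d' fst_d(2) h\<psi>)
    qed
    moreover have "(snd e \<circ> chart_inv c) (h y) = (snd e \<circ> chart_inv d) y" if "y \<in> snd d ` (fst d \<inter> fst e)" for y
      using that img inv_d by auto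
    ultimately have "smooth_on (snd d ` (fst d \<inter> fst e)) (snd e \<circ> chart_inv d)"
      by (rule smooth_on_cong[OF open1(1), THEN iffD1, rotated])
    moreover have "smooth_on (snd e ` (fst d \<inter> fst e)) (\<lambda>y. \<psi> ((snd c \<circ> chart_inv e) y))"
    proof (rule smooth_on_compose[OF open2 UV(1) _ _ UV(5)])
      show "smooth_on (snd e ` (fst d \<inter> fst e)) (snd c \<circ> chart_inv e)"
        by (rule smooth_on_subset[OF ce(2)]) (auto simp: fst_d')
      show "(snd c \<circ> chart_inv e) ` snd e ` (fst d \<inter> fst e) \<subseteq> U"
        using chart_e by (auto simp: fst_d')
    qed
    then have "smooth_on (snd e ` (fst d \<inter> fst e)) (snd d \<circ> chart_inv e)"
      by (simp add: d_def o_def)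
    ultimately show ?thesis by (simp add: smoothly_compatible_def)
  qed
  then show "d \<in> A" using A chart_d unfolding smooth_structure_def by blast
qed

text \<open>
  The straightened coordinates form a chart in which the distribution is the same coordinate plane
  \<open>T\<close> at every point, so the slices parallel to \<open>T\<close> are integral manifolds.
\<close>

lemma integrable_if_kernel_stationary:
  fixes A :: "('m::{t2_space, second_countable_topology}, 'r::finite, 'n::{finite, linorder}) chart set"
    and W :: "'n option \<Rightarrow> ('m, 'r) foliation" and \<alpha> :: 'n
  assumes A: "smooth_structure A" and web: "web A W"
    and closed: "closed_form A W (fst c) (snd c) F" and cof: "adapted_coframe A W D \<omega>"
    and "l < k" and \<alpha>: "\<alpha> \<in> idx_a l k"
    and stat: "\<And>y. y \<in> snd c ` fst c \<Longrightarrow> kernel_stationary (idx_p l) (idx_a l k) F y"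
    and x: "x \<in> fst c \<inter> D"
  shows "\<exists>N. x \<in> N \<and> N \<subseteq> D \<and> integral_manifold A (reduct_distribution k l \<omega>) N"
proof -
  let ?P = "idx_p l :: 'n set" and ?I = "idx_a l k :: 'n set" and ?S = "idx_s k :: 'n set"
  note part = index_groups[OF \<open>l < k\<close>, where 'n = 'n]
  note cf = closed_form_facts[OF A web closed cof]
  let ?\<Omega> = "snd c ` (fst c \<inter> D)"
  have "open D" using cof by (simp add: adapted_coframe_def)
  then have \<Omega>: "open ?\<Omega>" "snd c x \<in> ?\<Omega>" "?\<Omega> \<subseteq> snd c ` fst c"
    using chart_open_image[OF cf(2)] x by blast+
  let ?\<psi> = "replace_coord \<alpha> (F \<circ> freeze ?P (snd c x))"
  obtain U V h where U: "open U" "U \<subseteq> ?\<Omega>" "snd c x \<in> U" and V: "open V"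
    and hom: "homeomorphism U V ?\<psi> h" and smooth: "smooth_on U ?\<psi>" "smooth_on V h"
    and dh: "\<And>y w \<beta>. y \<in> V \<Longrightarrow> \<beta> \<noteq> \<alpha> \<Longrightarrow> frechet_derivative h (at y) w $ \<beta> = w $ \<beta>"
    and ker: "\<And>y w. y \<in> V \<Longrightarrow> (\<forall>\<sigma>\<in>?S. w $ \<sigma> = 0) \<Longrightarrow>
       frechet_derivative F (at (h y)) (block ?I (frechet_derivative h (at y) w)) = 0 \<longleftrightarrow> w $ \<alpha> = 0"
  proof (rule straightening[OF part \<alpha> \<Omega>(1,2) smooth_on_subset[OF cf(3) \<Omega>(3)]])
    show "det (partial_jacobian F \<alpha> y) \<noteq> 0" "kernel_stationary ?P ?I F y" if "y \<in> ?\<Omega>" for y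
      using that \<Omega>(3) cf(5) stat by blast+
  qed (rule that)
  have UV: "U \<subseteq> snd c ` fst c" using U(2) \<Omega>(3) by blast
  define d where "d = (chart_inv c ` U, ?\<psi> \<circ> snd c)"
  note d = changed_chart[OF A cf(1) U(1) UV V hom smooth, folded d_def]
  have chart_d: "is_chart d" using smooth_structure_chart[OF A d(1)] .
  have snd_d: "snd d z = ?\<psi> (snd c z)" for z by (simp add: d_def)
  have fst_d: "z \<in> fst c \<inter> D" "snd c z \<in> U" if "z \<in> fst d" for z
    using that U(2) cf(2) unfolding d_def by auto
  have h_d: "h (snd d z) = snd c z" if "z \<in> fst d" for z
    using hom fst_d(2)[OF that] by (simp add: snd_d homeomorphism_def)
  have x_d: "x \<in> fst d"
    using U(3) x cf(2) by (auto simp: d_def intro!: image_eqI[of x "chart_inv c" "snd c x"])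
  define T where "T = {w :: ('r, 'n) coords. (\<forall>\<sigma>\<in>?S. w $ \<sigma> = 0) \<and> w $ \<alpha> = 0}"
  have T: "subspace T" by (auto simp: T_def subspace_def)
  have \<Delta>: "reduct_distribution k l \<omega> d z = T" if z: "z \<in> fst d" for z
  proof -
    have zV: "snd d z \<in> V" using z d(2) by blast
    let ?h' = "frechet_derivative h (at (snd d z))"
    have "differential d (snd c) z = ?h'"
    proof (rule differential_in_chart[OF chart_d z smooth_on_has_derivative[OF smooth(2) zV]])
      show "snd c z' = h (snd d z')" if "z' \<in> fst d" for z' using h_d[OF that] by simp
    qed
    then have trans: "\<omega> \<xi> d z w = \<omega> \<xi> c z (?h' w)" for \<xi> w
      using cof d(1) cf(1) z fst_d(1)[OF z] unfolding adapted_coframe_def one_form_on_def by (metis Int_iff)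
    have "\<alpha> \<notin> ?S" using \<alpha> part(4) by blast
    then have "(\<forall>\<sigma>\<in>?S. \<omega> (Some \<sigma>) d z w = 0) \<longleftrightarrow> (\<forall>\<sigma>\<in>?S. w $ \<sigma> = 0)" for w
      using dh[OF zV] coframe_kernels(1)[OF A web closed cof fst_d(1)[OF z]] trans by metis
    moreover have "(\<Sum>\<beta>\<in>?I. \<omega> (Some \<beta>) d z w) = 0 \<longleftrightarrow> w $ \<alpha> = 0" if "\<forall>\<sigma>\<in>?S. w $ \<sigma> = 0" for w
    proof -
      have "?I \<noteq> {}" using \<alpha> by blast
      then show ?thesis
        unfolding trans ker[OF zV that, symmetric] h_d[OF z]
        by (rule coframe_block_sum_eq_0_iff[OF A web closed cof fst_d(1)[OF z]])
    qed
    ultimately show ?thesis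
      unfolding reduct_distribution_def T_def by blast
  qed
  define N where "N = {z \<in> fst d. snd d z - snd d x \<in> T}"
  have "integral_manifold A (reduct_distribution k l \<omega>) N"
    unfolding integral_manifold_def
  proof (rule ballI, rule bexI[OF _ d(1)], rule exI[of _ T], intro conjI ballI)
    fix y assume y: "y \<in> N"
    then show "y \<in> fst d" by (simp add: N_def)
    show "subspace T" by (fact T)
    have "w - snd d x \<in> T \<longleftrightarrow> w - snd d y \<in> T" for w
    proof -
      have "(w - snd d x) - (w - snd d y) \<in> T" using y by (simp add: N_def)
      then show ?thesis
        using subspace_diff[OF T, of "w - snd d x" "(w - snd d x) - (w - snd d y)"]
          subspace_add[OF T, of "w - snd d y" "(w - snd d x) - (w - snd d y)"] by auto
    qed
    moreover have "w - snd d y \<in> T \<longleftrightarrow> w \<in> (\<lambda>t. snd d y + t) ` T" for w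
      by (auto simp: image_iff) (metis add_diff_cancel_left' diff_add_cancel add.commute)+
    ultimately show "snd d ` (fst d \<inter> N) = snd d ` fst d \<inter> (\<lambda>t. snd d y + t) ` T"
      unfolding N_def by blast
    show "reduct_distribution k l \<omega> d z = T" if "z \<in> fst d \<inter> N" for z
      using \<Delta> that by blast
  qed
  moreover have "x \<in> N" using x_d subspace_0[OF T] by (simp add: N_def)
  moreover have "N \<subseteq> D" using fst_d(1) by (auto simp: N_def)
  ultimately show ?thesis by blast
qed

text \<open>
  In a slice chart of an integral manifold the tangent vectors in \<open>T\<close> are constant, and the form
  \<open>\<Theta> = \<Sum>\<^sub>\<alpha>\<^sub>\<in>\<^sub>I \<omega>\<^sub>\<alpha>\<close> vanishes on them all along the slice; therefore \<open>d\<Theta>(u,v) = 0\<close> for \<open>u\<close>, \<open>v\<close> in \<open>T\<close>,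
  which contains the vectors that test the torsion.
\<close>

lemma torsion_condition_if_integrable:
  fixes A :: "('m::{t2_space, second_countable_topology}, 'r::finite, 'n::{finite, linorder}) chart set"
    and W :: "'n option \<Rightarrow> ('m, 'r) foliation"
  assumes A: "smooth_structure A" and web: "web A W"
    and cof: "adapted_coframe A W D \<omega>" and tor: "torsion_tensor A D \<omega> a" and "l < k"
    and int: "integrable_distribution A D (reduct_distribution k l \<omega>)" and x: "x \<in> D"
  shows "torsion_condition (idx_p l) (idx_a l k) a x"
proof -
  let ?P = "idx_p l :: 'n set" and ?I = "idx_a l k :: 'n set" and ?S = "idx_s k :: 'n set"
  note part = index_groups[OF \<open>l < k\<close>, where 'n = 'n]
  obtain N where N: "x \<in> N" "N \<subseteq> D" "integral_manifold A (reduct_distribution k l \<omega>) N"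
    using int x unfolding integrable_distribution_def by blast
  then obtain c T where c: "c \<in> A" "x \<in> fst c" and T: "subspace T"
    and slice: "snd c ` (fst c \<inter> N) = snd c ` fst c \<inter> (\<lambda>t. snd c x + t) ` T"
    and \<Delta>: "\<And>z. z \<in> fst c \<inter> N \<Longrightarrow> reduct_distribution k l \<omega> c z = T"
    unfolding integral_manifold_def by blast
  have chart: "is_chart c" using smooth_structure_chart[OF A c(1)] .
  have xD: "x \<in> fst c \<inter> D" using c(2) x by blast
  let ?\<Theta> = "\<lambda>v y. \<Sum>\<beta>\<in>?I. \<omega> (Some \<beta>) c (chart_inv c y) v"
  have "open D" using cof by (simp add: adapted_coframe_def)
  then have openY: "open (snd c ` (fst c \<inter> D))" using chart chart_open_image by blast
  have smooth: "smooth_on (snd c ` (fst c \<inter> D)) (?\<Theta> v)" for v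
    using adapted_form_smooth[OF cof c(1)] by (intro smooth_on_sum openY)
  have zero: "frechet_derivative (?\<Theta> v) (at (snd c x)) u = 0" if u: "u \<in> T" and v: "v \<in> T" for u v
  proof (rule derivative_zero_along_line[OF smooth_on_has_derivative[OF smooth]])
    show "snd c x \<in> snd c ` (fst c \<inter> D)" using xD by blast
    show "open (snd c ` fst c)" using chart by (simp add: is_chart_def)
    show "snd c x \<in> snd c ` fst c" using c(2) by blast
    fix t assume "snd c x + t *\<^sub>R u \<in> snd c ` fst c"
    then have "snd c x + t *\<^sub>R u \<in> snd c ` (fst c \<inter> N)"
      unfolding slice using subspace_scale[OF T u] by blast
    then obtain z where z: "z \<in> fst c \<inter> N" "snd c x + t *\<^sub>R u = snd c z" by blast
    then have "v \<in> reduct_distribution k l \<omega> c z" using v \<Delta> by blast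
    then show "?\<Theta> v (snd c x + t *\<^sub>R u) = 0"
      using z chart by (simp add: reduct_distribution_def)
  qed
  show ?thesis
    unfolding torsion_condition_iff_ext_deriv[OF web cof tor c(1) xD part(2)]
  proof (intro ballI allI impI)
    fix p u v i
    assume p: "p \<in> ?P" and u: "\<forall>\<beta>. \<beta> \<noteq> p \<longrightarrow> \<omega> (Some \<beta>) c x u = 0"
      and v: "\<forall>\<beta>. \<beta> \<notin> ?I \<longrightarrow> \<omega> (Some \<beta>) c x v = 0" "(\<Sum>\<alpha>\<in>?I. \<omega> (Some \<alpha>) c x v) = 0"
    have "p \<notin> ?I" "p \<notin> ?S" using p part by blast+
    then have "\<forall>\<beta>\<in>?I. \<omega> (Some \<beta>) c x u = 0" "\<forall>\<beta>\<in>?S. \<omega> (Some \<beta>) c x u = 0"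
      using u by metis+
    moreover have "\<forall>\<beta>\<in>?S. \<omega> (Some \<beta>) c x v = 0" using v(1) part(4) by blast
    ultimately have "u \<in> T" "v \<in> T"
      unfolding \<Delta>[of x, OF IntI[OF c(2) N(1)], symmetric] reduct_distribution_def using v(2) by simp_all
    then show "(\<Sum>\<alpha>\<in>?I. ext_deriv (form_comp (\<omega> (Some \<alpha>)) i) c x u v) = 0"
      unfolding sum_ext_deriv[OF cof c(1) chart xD] using zero by simp
  qed
qed


section \<open>The equivalence\<close>

lemma pos_surj:
  assumes "1 \<le> j" "j \<le> CARD('n)"
  obtains \<alpha> :: "'n::{finite, linorder}" where "pos \<alpha> = j"
proof -
  have "pos \<alpha> < pos \<beta>" if "\<alpha> < \<beta>" for \<alpha> \<beta> :: 'n
    unfolding pos_def using that by (intro psubset_card_mono) auto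
  then have inj: "inj (pos :: 'n \<Rightarrow> nat)"
    by (metis injI linorder_neqE less_irrefl)
  have "pos \<alpha> \<in> {1..CARD('n)}" for \<alpha> :: 'n
    unfolding pos_def by (auto simp: Suc_le_eq card_gt_0_iff intro: card_mono)
  then have "range (pos :: 'n \<Rightarrow> nat) \<subseteq> {1..CARD('n)}" by blast
  then have "range (pos :: 'n \<Rightarrow> nat) = {1..CARD('n)}"
    by (intro card_subset_eq) (auto simp: card_image inj)
  then show ?thesis using assms that by (metis atLeastAtMost_iff imageE)
qed

lemma locally_representable_iff:
  "locally_representable R E \<longleftrightarrow> (\<forall>x. \<exists>D \<phi> F B. (D, \<phi>, F) \<in> E \<and> x \<in> D \<and> (\<forall>\<alpha>. open (B \<alpha>)) \<and>
     \<phi> x \<in> product_domain B \<and> product_domain B \<subseteq> \<phi> ` D \<and> R B F)"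
  by (simp add: locally_representable_def Bex_def split_paired_Ex)

theorem theorem1:
  fixes A :: "('m::{t2_space, second_countable_topology}, 'r::finite, 'n::{finite, linorder}) chart set"
    and W :: "'n option \<Rightarrow> ('m, 'r) foliation"
    and frames :: "('m set \<times> ('n option \<Rightarrow> ('m, 'r, 'n, real ^ 'r) form) \<times>
                    ('n \<Rightarrow> 'n \<Rightarrow> 'r \<Rightarrow> 'r \<Rightarrow> 'r \<Rightarrow> 'm \<Rightarrow> real)) set"
    and eqns :: "('m set \<times> ('m \<Rightarrow> ('r, 'n) coords) \<times> (('r, 'n) coords \<Rightarrow> real ^ 'r)) set"
    and n k l :: nat
  assumes "n = CARD('n)" and "1 < k" and "k < n" and "1 \<le> l" and "l < k"
    and "smooth_structure A"
    and "web A W"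
    and "\<And>D \<omega> a. (D, \<omega>, a) \<in> frames \<Longrightarrow> adapted_coframe A W D \<omega> \<and> torsion_tensor A D \<omega> a"
    and "(\<Union>(D, \<omega>, a)\<in>frames. D) = UNIV"
    and "\<And>D \<phi> F. (D, \<phi>, F) \<in> eqns \<Longrightarrow> closed_form A W D \<phi> F"
    and "(\<Union>(D, \<phi>, F)\<in>eqns. D) = UNIV"
  shows "(has_reducible_reduct_subweb k l eqns \<longleftrightarrow>
            (\<forall>(D, \<omega>, a)\<in>frames. \<forall>x\<in>D. \<forall>p\<in>idx_p l. \<forall>\<alpha>\<in>idx_a l k. \<forall>\<beta>\<in>idx_a l k. \<forall>i j m.
               a p \<alpha> i j m x = a p \<beta> i j m x)) \<and>
         ((\<forall>(D, \<omega>, a)\<in>frames. \<forall>x\<in>D. \<forall>p\<in>idx_p l. \<forall>\<alpha>\<in>idx_a l k. \<forall>\<beta>\<in>idx_a l k. \<forall>i j m.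
               a p \<alpha> i j m x = a p \<beta> i j m x) \<longleftrightarrow>
            (\<forall>(D, \<omega>, a)\<in>frames. integrable_distribution A D (reduct_distribution k l \<omega>))) \<and>
         ((\<forall>(D, \<omega>, a)\<in>frames. integrable_distribution A D (reduct_distribution k l \<omega>)) \<longleftrightarrow>
            has_reducible_closed_form k l eqns)"
proof -
  let ?P = "idx_p l :: 'n set" and ?I = "idx_a l k :: 'n set"
  let ?tor = "\<forall>(D, \<omega>, a)\<in>frames. \<forall>x\<in>D. torsion_condition ?P ?I a x"
  let ?int = "\<forall>(D, \<omega>, a)\<in>frames. integrable_distribution A D (reduct_distribution k l \<omega>)"
  let ?red = "has_reducible_reduct_subweb k l eqns"
  let ?cf = "has_reducible_closed_form k l eqns"
  note part = index_groups[OF \<open>l < k\<close>, where 'n = 'n]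
  obtain \<alpha> :: 'n where "pos \<alpha> = k" using pos_surj[of k, where 'n = 'n] assms(1-3) by auto
  then have \<alpha>: "\<alpha> \<in> ?I" using \<open>l < k\<close> by (simp add: idx_a_def)
  then have I: "?I \<noteq> {}" by blast
  have iff: "kernel_stationary ?P ?I F (\<phi> x) \<longleftrightarrow> torsion_condition ?P ?I a x"
    if "(D, \<omega>, a) \<in> frames" "(D', \<phi>, F) \<in> eqns" "x \<in> D" "x \<in> D'" for D \<omega> a D' \<phi> F x
    using kernel_stationary_iff_torsion_condition[OF assms(6,7), of "(D', \<phi>)" F D \<omega> a x ?P ?I]
      assms(8)[OF that(1)] assms(10)[OF that(2)] that(3,4) part(2) I by simp
  have eqn: "open (\<phi> ` D)" "smooth_on (\<phi> ` D) F" "\<And>y. y \<in> \<phi> ` D \<Longrightarrow> det (partial_jacobian F \<alpha> y) \<noteq> 0"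
    if "(D, \<phi>, F) \<in> eqns" for D \<phi> F
    using assms(10)[OF that] smooth_structure_chart[OF assms(6), of "(D, \<phi>)"]
    by (auto simp: closed_form_def is_chart_def)
  have covered: "\<exists>D \<omega> a. (D, \<omega>, a) \<in> frames \<and> x \<in> D" "\<exists>D \<phi> F. (D, \<phi>, F) \<in> eqns \<and> x \<in> D" for x
  proof -
    have "x \<in> (\<Union>(D, \<omega>, a)\<in>frames. D)" "x \<in> (\<Union>(D, \<phi>, F)\<in>eqns. D)"
      unfolding assms(9,11) by (rule UNIV_I)+
    then show "\<exists>D \<omega> a. (D, \<omega>, a) \<in> frames \<and> x \<in> D" "\<exists>D \<phi> F. (D, \<phi>, F) \<in> eqns \<and> x \<in> D"
      unfolding UN_iff case_prod_beta by (metis prod.collapse)+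
  qed

  have stat: "kernel_stationary ?P ?I F y" if ?tor "(D, \<phi>, F) \<in> eqns" "y \<in> \<phi> ` D" for D \<phi> F y
  proof -
    obtain x where "x \<in> D" "y = \<phi> x" using \<open>y \<in> \<phi> ` D\<close> by blast
    moreover obtain D' \<omega> a where "(D', \<omega>, a) \<in> frames" "x \<in> D'" using covered by blast
    ultimately show ?thesis using iff that(1,2) by fast
  qed

  have tor_cf: ?cf if ?tor
    unfolding has_reducible_closed_form_def locally_representable_iff
  proof
    fix x
    obtain D \<phi> F where E: "(D, \<phi>, F) \<in> eqns" "x \<in> D" using covered by blast
    then have "\<phi> x \<in> \<phi> ` D" by blast
    then obtain B where "\<And>\<beta>. open (B \<beta>)" "\<phi> x \<in> product_domain B" "product_domain B \<subseteq> \<phi> ` D"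
      "jointly_reducible_on k l B F"
      using jointly_reducible_if_kernel_stationary[OF \<open>l < k\<close> \<alpha> eqn(1)[OF E(1)] _ eqn(2,3)[OF E(1)]
          stat[OF \<open>?tor\<close> E(1)]] by metis
    with E show "\<exists>D \<phi> F B. (D, \<phi>, F) \<in> eqns \<and> x \<in> D \<and> (\<forall>\<alpha>. open (B \<alpha>)) \<and>
        \<phi> x \<in> product_domain B \<and> product_domain B \<subseteq> \<phi> ` D \<and> jointly_reducible_on k l B F"
      by metis
  qed
  have cf_red: ?red if ?cf
    using that fibrewise_reducible_if_jointly_reducible[OF \<open>l < k\<close>]
    unfolding has_reducible_closed_form_def has_reducible_reduct_subweb_def locally_representable_iff
    by metis
  have red_tor: ?tor if ?red
  proof (clarify)
    fix D \<omega> a x assume fr: "(D, \<omega>, a) \<in> frames" "x \<in> D"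
    obtain D' \<phi> F B where E: "(D', \<phi>, F) \<in> eqns" "x \<in> D'" and B: "\<And>\<beta>. open (B \<beta>)"
      "\<phi> x \<in> product_domain B" "product_domain B \<subseteq> \<phi> ` D'" "fibrewise_reducible_on k l B F"
      using \<open>?red\<close> unfolding has_reducible_reduct_subweb_def locally_representable_iff by metis
    have "kernel_stationary ?P ?I F (\<phi> x)"
      using kernel_stationary_if_fibrewise_reducible[OF \<open>l < k\<close> \<alpha> B(1) smooth_on_subset[OF eqn(2)[OF E(1)] B(3)] _ B(4,2)]
        eqn(3)[OF E(1)] B(3) by blast
    then show "torsion_condition ?P ?I a x" using iff fr E by blast
  qed
  have tor_int: ?int if ?tor
  proof (clarify)
    fix D \<omega> a assume fr: "(D, \<omega>, a) \<in> frames"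
    show "integrable_distribution A D (reduct_distribution k l \<omega>)"
      unfolding integrable_distribution_def
    proof
      fix x assume "x \<in> D"
      obtain D' \<phi> F where E: "(D', \<phi>, F) \<in> eqns" "x \<in> D'" using covered by blast
      show "\<exists>N. x \<in> N \<and> N \<subseteq> D \<and> integral_manifold A (reduct_distribution k l \<omega>) N"
        using integrable_if_kernel_stationary[OF assms(6,7), of "(D', \<phi>)" F D \<omega> l k \<alpha> x]
          assms(8)[OF fr] assms(10)[OF E(1)] \<open>l < k\<close> \<alpha> stat[OF \<open>?tor\<close> E(1)] \<open>x \<in> D\<close> E(2) by simp
    qed
  qed
  have int_tor: ?tor if ?int
    using torsion_condition_if_integrable[OF assms(6,7) _ _ \<open>l < k\<close>] assms(8) that by blast
  have "(?red \<longleftrightarrow> ?tor) \<and> (?tor \<longleftrightarrow> ?int) \<and> (?int \<longleftrightarrow> ?cf)"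
    using tor_cf cf_red red_tor tor_int int_tor by blast
  then show ?thesis unfolding torsion_condition_def .
qed

end
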